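(* Let $k\in\mathbb N$, $h\in\mathbb Z$ with $\gcd(h,k)=1$, and let $q=\zeta_k^h$. With the third order mock theta functions $\psi,\phi,\nu,\omega,\rho,f,\chi$ (evaluated by their defining series) and the truncated companion series $(\widetilde{\psi}_a)_{[k]}$, $(\widetilde{\phi}_a)_{[k]}$, etc., defined in the context, the following identities hold: \begin{align*} \psi(-q) &= \tfrac13(\widetilde{\psi}_a)_{[k]}(-q) && \text{for } k\equiv 1 \pmod 2,\\ \phi(-q) &= \tfrac23+\tfrac13(\widetilde{\phi}_a)_{[k]}(-q) && \text{for } k\equiv 1\pmod 2,\\ \nu(-q) &= -\tfrac13(\widetilde{\nu}_a)_{[k]}(-q) && \text{for } k\equiv 0\pmod 4,\\ \omega(q^2) &= -\tfrac13(\widetilde{\omega}_a)_{[k]}(q^2) && \text{for } k\equiv 0\pmod 4,\\ \rho(q^2) &= -\tfrac13(\widetilde{\rho}_a)_{[k]}(q^2) && \text{for } k\equiv 0\pmod{12},\\ f(q) &= \tfrac13(\widetilde{f}_a)_{[k]}(q) = \tfrac43+\tfrac13(\widetilde{\mathfrak f}_a)_{[k]}(q) && \text{for } k\equiv 1\pmod 2,\\ \chi(q) &= \tfrac13(\widetilde{\chi}_a)_{[k]}(q) = \tfrac13+\tfrac13(\widetilde{X}_a)_{[k]}(q) && \text{for } k\equiv 3\pmod 6. \end{align*}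
   Context: Notation: $\zeta_N:=e^{2\pi i/N}$; $(a;q)_n:=\prod_{j=0}^{n-1}(1-aq^j)$. Third order mock theta functions: $$f(q)=\sum_{n\ge0}\frac{q^{n^2}}{(-q;q)_n^2},\quad \omega(q)=\sum_{n\ge0}\frac{q^{2n(n+1)}}{(q;q^2)_{n+1}^2},\quad \psi(q)=\sum_{n\ge1}\frac{q^{n^2}}{(q;q^2)_n},\quad \phi(q)=\sum_{n\ge0}\frac{q^{n^2}}{(-q^2;q^2)_n},$$ $$\nu(q)=\sum_{n\ge0}\frac{q^{n^2+n}}{(-q;q^2)_{n+1}},\quad \chi(q)=\sum_{n\ge0}\frac{q^{n^2}}{\prod_{j=1}^n(1-q^j+q^{2j})},\quad \rho(q)=\sum_{n\ge0}\frac{q^{2n(n+1)}}{\prod_{j=0}^n(1+q^{2j+1}+q^{4j+2})}.$$ Companion series: $$\widetilde{\psi}_a(q)=\sum_{n\ge0}(-q^2;q^2)_nq^{n+1},\qquad \widetilde{\phi}_a(q)=1+\sum_{n\ge0}(q;q^2)_n(-1)^nq^{2n+1},\qquad \widetilde{\nu}_a(q)=\sum_{n\ge0}(q;q^2)_n(-1)^nq^n,$$ $$\widetilde{\omega}_a(q)=q^{-1/2}\sum_{n\ge0}(-q^{1/2};q)_nq^{n/2},\qquad \widetilde{\rho}_a(q)=-\tfrac12q^{-1/2}\sum_{n\ge0}(-q^{1/2};q)_nq^{n/2},$$ $$\widetilde{f}_a(q)=4\sum_{n\ge0}(-q^2;q^2)_n(-1)^nq^{n+1},\qquad \widetilde{\mathfrak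 f}_a(q)=2-2\sum_{n\ge0}(-q;q^2)_n(-1)^nq^{2n+1},$$ $$\widetilde{\chi}_a(q)=\sum_{n\ge0}(-q^2;q^2)_n(-1)^nq^{n+1},\qquad \widetilde{X}_a(q)=\tfrac12-\tfrac12\sum_{n\ge0}(-q;q^2)_n(-1)^nq^{2n+1}.$$ When $\widetilde{\omega}_a$ or $\widetilde{\rho}_a$ is evaluated at $q^2$, the symbol $(q^2)^{1/2}$ means $q$; e.g. $\widetilde{\omega}_a(q^2)=q^{-1}\sum_{n\ge0}(-q;q^2)_nq^n$. Truncation: for a series $S(x)=\sum_{n\ge0}a_n(x)$, $S_{[k]}(x):=\sum_{0\le n\le k-1}a_n(x)$. For the companion series above, the subscript $[k]$ means that the sum $\sum_{n\ge0}$ is replaced by $\sum_{n=0}^{k-1}$, while additive constants and multiplicative prefactors are kept; e.g. $(\widetilde{\phi}_a)_{[k]}(q)=1+\sum_{n=0}^{k-1}(q;q^2)_n(-1)^nq^{2n+1}$. *)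

theory Defs
  imports Complex_Main
begin

definition zeta :: "nat \<Rightarrow> complex" where
  "zeta N = exp (2 * of_real pi * \<i> / of_nat N)"

definition qpoch :: "complex \<Rightarrow> complex \<Rightarrow> nat \<Rightarrow> complex" where
  "qpoch a q n = (\<Prod>j<n. 1 - a * q ^ j)"

text \<open>
  Third order mock theta functions. For each of them the denominators and the terms of the
  defining series are named separately: division by zero and the sum of a divergent series
  have default values in HOL, so that saying that such a function has a value at a point of
  the unit circle requires the predicate \<open>well_defined_series\<close> below.
\<close>

definition well_defined_series :: "(nat \<Rightarrow> complex) \<Rightarrow> (nat \<Rightarrow> complex) \<Rightarrow> bool" where
  "well_defined_series den trm \<longleftrightarrow> (\<forall>n. den n \<noteq> 0) \<and> summable trm"

definition mock_f_den :: "complex \<Rightarrow> nat \<Rightarrow> complex" where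
  "mock_f_den q n = (qpoch (- q) q n)\<^sup>2"

definition mock_f_term :: "complex \<Rightarrow> nat \<Rightarrow> complex" where
  "mock_f_term q n = q ^ (n\<^sup>2) / mock_f_den q n"

definition mock_f :: "complex \<Rightarrow> complex" where
  "mock_f q = (\<Sum>n. mock_f_term q n)"

definition mock_omega_den :: "complex \<Rightarrow> nat \<Rightarrow> complex" where
  "mock_omega_den q n = (qpoch q (q\<^sup>2) (n + 1))\<^sup>2"

definition mock_omega_term :: "complex \<Rightarrow> nat \<Rightarrow> complex" where
  "mock_omega_term q n = q ^ (2 * n * (n + 1)) / mock_omega_den q n"

definition mock_omega :: "complex \<Rightarrow> complex" where
  "mock_omega q = (\<Sum>n. mock_omega_term q n)"

text \<open>The series for \<open>\<psi>\<close> starts at \<open>n = 1\<close>; here its index is shifted to start at \<open>0\<close>.\<close>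

definition mock_psi_den :: "complex \<Rightarrow> nat \<Rightarrow> complex" where
  "mock_psi_den q n = qpoch q (q\<^sup>2) (n + 1)"

definition mock_psi_term :: "complex \<Rightarrow> nat \<Rightarrow> complex" where
  "mock_psi_term q n = q ^ ((n + 1)\<^sup>2) / mock_psi_den q n"

definition mock_psi :: "complex \<Rightarrow> complex" where
  "mock_psi q = (\<Sum>n. mock_psi_term q n)"

definition mock_phi_den :: "complex \<Rightarrow> nat \<Rightarrow> complex" where
  "mock_phi_den q n = qpoch (- (q\<^sup>2)) (q\<^sup>2) n"

definition mock_phi_term :: "complex \<Rightarrow> nat \<Rightarrow> complex" where
  "mock_phi_term q n = q ^ (n\<^sup>2) / mock_phi_den q n"

definition mock_phi :: "complex \<Rightarrow> complex" where
  "mock_phi q = (\<Sum>n. mock_phi_term q n)"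

definition mock_nu_den :: "complex \<Rightarrow> nat \<Rightarrow> complex" where
  "mock_nu_den q n = qpoch (- q) (q\<^sup>2) (n + 1)"

definition mock_nu_term :: "complex \<Rightarrow> nat \<Rightarrow> complex" where
  "mock_nu_term q n = q ^ (n\<^sup>2 + n) / mock_nu_den q n"

definition mock_nu :: "complex \<Rightarrow> complex" where
  "mock_nu q = (\<Sum>n. mock_nu_term q n)"

definition mock_chi_den :: "complex \<Rightarrow> nat \<Rightarrow> complex" where
  "mock_chi_den q n = (\<Prod>j=1..n. 1 - q ^ j + q ^ (2 * j))"

definition mock_chi_term :: "complex \<Rightarrow> nat \<Rightarrow> complex" where
  "mock_chi_term q n = q ^ (n\<^sup>2) / mock_chi_den q n"

definition mock_chi :: "complex \<Rightarrow> complex" where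
  "mock_chi q = (\<Sum>n. mock_chi_term q n)"

definition mock_rho_den :: "complex \<Rightarrow> nat \<Rightarrow> complex" where
  "mock_rho_den q n = (\<Prod>j=0..n. 1 + q ^ (2 * j + 1) + q ^ (4 * j + 2))"

definition mock_rho_term :: "complex \<Rightarrow> nat \<Rightarrow> complex" where
  "mock_rho_term q n = q ^ (2 * n * (n + 1)) / mock_rho_den q n"

definition mock_rho :: "complex \<Rightarrow> complex" where
  "mock_rho q = (\<Sum>n. mock_rho_term q n)"

text \<open>
  Truncated companion series: the sum runs over \<open>n < k\<close>, additive constants and prefactors
  are kept.
\<close>

definition psi_a_trunc :: "nat \<Rightarrow> complex \<Rightarrow> complex" where
  "psi_a_trunc k q = (\<Sum>n<k. qpoch (- (q\<^sup>2)) (q\<^sup>2) n * q ^ (n + 1))"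

definition phi_a_trunc :: "nat \<Rightarrow> complex \<Rightarrow> complex" where
  "phi_a_trunc k q = 1 + (\<Sum>n<k. qpoch q (q\<^sup>2) n * (-1) ^ n * q ^ (2 * n + 1))"

definition nu_a_trunc :: "nat \<Rightarrow> complex \<Rightarrow> complex" where
  "nu_a_trunc k q = (\<Sum>n<k. qpoch q (q\<^sup>2) n * (-1) ^ n * q ^ n)"

text \<open>
  The next two series involve \<open>q\<^bsup>1/2\<^esup>\<close>; the extra argument \<open>r\<close> is the chosen square root of
  \<open>q\<close> (so \<open>r\<^sup>2 = q\<close> is intended). At the point \<open>q\<^sup>2\<close> the square root is \<open>q\<close>.
\<close>

definition omega_a_trunc :: "nat \<Rightarrow> complex \<Rightarrow> complex \<Rightarrow> complex" where
  "omega_a_trunc k q r = inverse r * (\<Sum>n<k. qpoch (- r) q n * r ^ n)"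

definition rho_a_trunc :: "nat \<Rightarrow> complex \<Rightarrow> complex \<Rightarrow> complex" where
  "rho_a_trunc k q r = - (1/2) * inverse r * (\<Sum>n<k. qpoch (- r) q n * r ^ n)"

definition f_a_trunc :: "nat \<Rightarrow> complex \<Rightarrow> complex" where
  "f_a_trunc k q = 4 * (\<Sum>n<k. qpoch (- (q\<^sup>2)) (q\<^sup>2) n * (-1) ^ n * q ^ (n + 1))"

definition frak_f_a_trunc :: "nat \<Rightarrow> complex \<Rightarrow> complex" where
  "frak_f_a_trunc k q = 2 - 2 * (\<Sum>n<k. qpoch (- q) (q\<^sup>2) n * (-1) ^ n * q ^ (2 * n + 1))"

definition chi_a_trunc :: "nat \<Rightarrow> complex \<Rightarrow> complex" where
  "chi_a_trunc k q = (\<Sum>n<k. qpoch (- (q\<^sup>2)) (q\<^sup>2) n * (-1) ^ n * q ^ (n + 1))"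

definition X_a_trunc :: "nat \<Rightarrow> complex \<Rightarrow> complex" where
  "X_a_trunc k q =
     1/2 - 1/2 * (\<Sum>n<k. qpoch (- q) (q\<^sup>2) n * (-1) ^ n * q ^ (2 * n + 1))"

end

theory Submission
  imports Defs "HOL-Computational_Algebra.Polynomial"
begin

text \<open>
  Write \<open>(a)\<^sub>n\<close> for \<open>qpoch a q n\<close>. At a primitive \<open>k\<close>-th root of unity \<open>(x)\<^sub>k = 1 - x\<^sup>k\<close>, so the terms of each
  mock theta series pick up a constant factor when the index grows by a period, and the series is
  its sum over one period times a rational number. This leaves identities between the finite sums
  \<open>G(x, t) = \<Sum> (x)\<^sub>n t\<^sup>n\<close> and \<open>T(a, b) = \<Sum> q\<^sup>n (a)\<^sub>n (b)\<^sub>n\<close> over a period, with all parameters having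
  \<open>k\<close>-th power \<open>-1\<close>. Both satisfy first-order inhomogeneous recurrences under multiplying a
  parameter by \<open>q\<close>.

  Solving the recurrence of \<open>G\<close> in \<open>t\<close> gives the series \<open>\<psi>\<close>, \<open>\<phi>\<close>, \<open>\<nu>\<close>; reversing the order of
  summation turns \<open>f\<close>, \<open>\<chi>\<close>, \<open>\<omega>\<close>, \<open>\<rho>\<close> into values of \<open>T\<close>. Along a suitable line \<open>T\<close> in base \<open>q\<close> (or
  \<open>q\<^sup>4\<close>) and \<open>G\<close> in base \<open>q\<^sup>2\<close> obey the same recurrence; going once around the period multiplies
  their difference by a constant other than 1, so the difference vanishes: this handles
  \<open>f\<close> and \<open>\<omega>\<close>. For \<open>\<chi>\<close> and \<open>\<rho>\<close> one sums \<open>V(a) = T(a, q/a)\<close> over the three cube roots of unity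
  times \<open>a\<close>: the recurrence \<open>V(aq) = -c(a + a\<^sup>2) - a\<^sup>3 V(a)\<close> becomes homogeneous, which forces the sum to
  vanish off the unit circle and, by continuity, on it.
\<close>

section \<open>Roots of unity and the finite q-Pochhammer symbol\<close>

definition primitive_root :: "nat \<Rightarrow> complex \<Rightarrow> bool" where
  "primitive_root k q \<longleftrightarrow> k > 0 \<and> q ^ k = 1 \<and> (\<forall>j. q ^ j = 1 \<longrightarrow> k dvd j)"

lemma primitive_root_pos: "primitive_root k q \<Longrightarrow> k > 0"
  and primitive_root_power: "primitive_root k q \<Longrightarrow> q ^ k = 1"
  and primitive_root_dvd: "primitive_root k q \<Longrightarrow> q ^ j = 1 \<Longrightarrow> k dvd j"
  by (auto simp: primitive_root_def)

lemma primitive_root_nonzero: "primitive_root k q \<Longrightarrow> q \<noteq> 0"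
  by (auto simp: primitive_root_def power_0_left split: if_splits)

lemma primitive_root_norm: "primitive_root k q \<Longrightarrow> norm q = 1"
proof -
  assume q: "primitive_root k q"
  have "norm q ^ k = 1"
    using primitive_root_power[OF q] by (simp flip: norm_power)
  then show "norm q = 1"
    using primitive_root_pos[OF q] power_eq_imp_eq_base[of "norm q" k 1] by simp
qed

lemma zeta_power: "(zeta k powi h) ^ j = cis (2 * pi * (of_int h * of_nat j / of_nat k))"
proof -
  have "zeta k = cis (2 * pi / real k)"
    by (simp add: zeta_def cis_conv_exp mult_ac)
  then show ?thesis
    by (simp add: cis_power_int Complex.DeMoivre mult_ac)
qed

text \<open>If the \<open>j\<close>-th power is 1, then \<open>h * j / k\<close> is an integer, and
  coprimality removes \<open>h\<close> from \<open>k dvd h * j\<close>.\<close>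

lemma primitive_root_zeta:
  assumes "k \<ge> 1" "gcd h (int k) = 1"
  shows "primitive_root k (zeta k powi h)"
  unfolding primitive_root_def
proof (intro conjI allI impI)
  show "k > 0" using assms by simp
  show "(zeta k powi h) ^ k = 1"
    using assms unfolding zeta_power by simp
  fix j assume "(zeta k powi h) ^ j = 1"
  then have "cos (2 * pi * (of_int h * of_nat j / of_nat k)) = 1"
    unfolding zeta_power by (simp add: complex_eq_iff)
  then obtain n :: int where n: "2 * pi * (of_int h * of_nat j / of_nat k) = of_int n * 2 * pi"
    unfolding cos_one_2pi_int by blast
  then have "of_int h * of_nat j = (of_int n * of_nat k :: real)"
    using assms by (simp add: field_simps)
  then have "of_int (h * int j) = (of_int (n * int k) :: real)" by simp
  then have "h * int j = n * int k" by (simp only: of_int_eq_iff)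
  then have "int k dvd h * int j" by simp
  then have "int k dvd int j"
    using assms by (metis coprime_dvd_mult_right_iff coprime_iff_gcd_eq_1 gcd.commute)
  then show "k dvd j" by simp
qed

lemma primitive_root_power_div:
  assumes "primitive_root k q" "k = d * l"
  shows "primitive_root l (q ^ d)"
  using assms by (auto simp: primitive_root_def simp flip: power_mult)

lemma primitive_root_power_coprime:
  assumes "primitive_root k q" "coprime k d"
  shows "primitive_root k (q ^ d)"
  unfolding primitive_root_def
proof (intro conjI allI impI)
  show "k > 0" using assms(1) by (rule primitive_root_pos)
  show "(q ^ d) ^ k = 1"
    using primitive_root_power[OF assms(1)] by (metis power_mult mult.commute power_one)
  fix j assume "(q ^ d) ^ j = 1"
  then have "k dvd d * j"
    using primitive_root_dvd[OF assms(1)] by (simp flip: power_mult)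
  then show "k dvd j" using assms(2) by (simp add: coprime_dvd_mult_right_iff)
qed

lemma primitive_root_half:
  assumes "primitive_root (2 * m) q"
  shows "q ^ m = -1"
proof -
  have "m > 0" using primitive_root_pos[OF assms] by simp
  have "(q ^ m)\<^sup>2 = 1"
    using primitive_root_power[OF assms] by (simp add: power_mult mult.commute flip: power_mult)
  moreover have "q ^ m \<noteq> 1"
    using primitive_root_dvd[OF assms, of m] \<open>m > 0\<close> by (auto dest: dvd_imp_le)
  ultimately show ?thesis by (simp add: power2_eq_1_iff)
qed

section \<open>Periodicity and reflection of q-Pochhammer symbols\<close>

lemma qpoch_0 [simp]: "qpoch a q 0 = 1"
  by (simp add: qpoch_def)

lemma qpoch_Suc: "qpoch a q (Suc n) = qpoch a q n * (1 - a * q ^ n)"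
  by (simp add: qpoch_def)

lemma qpoch_add: "qpoch a q (m + n) = qpoch a q m * qpoch (a * q ^ m) q n"
  by (induction n) (simp_all add: qpoch_Suc power_add mult.assoc)

lemma qpoch_shift: "(1 - a) * qpoch (a * q) q n = qpoch a q n * (1 - a * q ^ n)"
  using qpoch_add[of a q 1 n] by (simp add: qpoch_Suc)

text \<open>Both sides are polynomials in \<open>x\<close> of degree at most \<open>k\<close>. They
  vanish at the \<open>k\<close> distinct inverse powers of \<open>q\<close> and both equal 1 at 0,
  which makes \<open>k + 1\<close> points of agreement.\<close>

lemma qpoch_full:
  assumes "primitive_root k q"
  shows "qpoch x q k = 1 - x ^ k"
proof -
  have q0: "q \<noteq> 0" using assms by (rule primitive_root_nonzero)
  have k: "k > 0" using assms by (rule primitive_root_pos)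
  define P where "P = (\<Prod>j<k. [:1, - (q ^ j):])"
  define R where "R = 1 - monom (1::complex) k"
  define A where "A = insert 0 ((\<lambda>j. inverse (q ^ j)) ` {..<k})"
  have "inj_on (\<lambda>j. inverse (q ^ j)) {..<k}"
  proof (rule linorder_inj_onI')
    fix i j assume ij: "i \<in> {..<k}" "j \<in> {..<k}" "i < j"
    have "q ^ (j - i) \<noteq> 1"
      using primitive_root_dvd[OF assms, of "j - i"] ij by (auto dest!: dvd_imp_le)
    then show "inverse (q ^ i) \<noteq> inverse (q ^ j)"
      using q0 ij by (auto simp: power_diff)
  qed
  then have card: "card A = Suc k"
    using q0 by (auto simp: A_def card_image card_insert_if)
  have "degree P \<le> k"
  proof -
    have "degree P \<le> (\<Sum>j<k. degree [:1, - (q ^ j):])"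
      unfolding P_def using degree_prod_sum_le[of "{..<k}" "\<lambda>j. [:1, - (q ^ j):]"]
      by (simp add: o_def)
    also have "\<dots> \<le> (\<Sum>j<k. 1)" by (intro sum_mono) auto
    finally show ?thesis by simp
  qed
  moreover have "degree R \<le> k"
    unfolding R_def by (intro degree_diff_le) (auto simp: degree_monom_le)
  moreover have "poly P y = poly R y" if "y \<in> A" for y
  proof (cases "y = 0")
    case False
    then obtain j where j: "j < k" "y = inverse (q ^ j)" using \<open>y \<in> A\<close> by (auto simp: A_def)
    have "y ^ k = 1"
      using primitive_root_power[OF assms] j by (simp add: power_inverse flip: power_mult)
         (metis mult.commute power_mult power_one)
    moreover have "1 - y * q ^ j = 0" using j q0 by simp
    then have "(\<Prod>i<k. 1 - y * q ^ i) = 0" using j by (intro prod_zero) auto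
    ultimately show ?thesis
      by (simp add: P_def R_def poly_prod poly_monom)
  qed (use k in \<open>simp add: P_def R_def poly_prod poly_monom power_0_left\<close>)
  ultimately have "P = R"
    by (intro poly_eqI_degree[of A]) (auto simp: card)
  then have "poly P x = poly R x" by simp
  then show ?thesis by (simp add: P_def R_def poly_prod poly_monom qpoch_def)
qed

text \<open>For \<open>x ^ k = -1\<close> the factor is 2; this is the source of the ratios -1/2 and
  1/4 of the mock theta series.\<close>

lemma qpoch_period:
  assumes "primitive_root k q"
  shows "qpoch x q (n + k) = (1 - x ^ k) * qpoch x q n"
  using qpoch_add[of x q k n] qpoch_full[OF assms] primitive_root_power[OF assms]
  by (simp add: add.commute)

lemma qpoch_nonzero:
  assumes "q ^ k = 1" "x ^ k \<noteq> 1"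
  shows "qpoch x q n \<noteq> 0"
proof
  assume "qpoch x q n = 0"
  then obtain j where "x * q ^ j = 1" by (auto simp: qpoch_def)
  then have "x ^ k * (q ^ k) ^ j = 1"
    by (metis power_mult_distrib power_mult mult.commute power_one)
  then show False using assms by simp
qed

lemma choose_two_Suc: "Suc n choose 2 = n + (n choose 2)"
  by (simp add: numeral_2_eq_2)

text \<open>The last \<open>n\<close> factors of the full product are 1 - x q^(k-j) = -x q^(-j) (1 -
  q^j / x) for j = 1, ..., n; collecting them gives \<open>qpoch (q / x) q n\<close> and a
  triangular power of \<open>q\<close>.\<close>

lemma qpoch_reflect:
  assumes "primitive_root k q" "x \<noteq> 0" "n \<le> k"
  shows "qpoch x q (k - n) * (- x) ^ n * qpoch (q / x) q n = (1 - x ^ k) * q ^ (Suc n choose 2)"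
  using \<open>n \<le> k\<close>
proof (induction n)
  case 0
  then show ?case using qpoch_full[OF assms(1)] by (simp add: numeral_2_eq_2)
next
  case (Suc n)
  have q0: "q \<noteq> 0" using assms by (intro primitive_root_nonzero)
  have "k - n = Suc (k - Suc n)" using Suc.prems by simp
  then have A: "qpoch x q (k - n) = qpoch x q (k - Suc n) * (1 - x * q ^ (k - Suc n))"
    by (simp add: qpoch_Suc)
  have "q ^ (k - Suc n) * q ^ Suc n = 1"
    using Suc.prems primitive_root_power[OF assms(1)]
    by (simp del: power_Suc flip: power_add)
  then have B: "q ^ Suc n * (1 - x * q ^ (k - Suc n)) = - x * (1 - q / x * q ^ n)"
    using assms(2) by (simp add: field_simps)

  have "Suc (Suc n) choose 2 = Suc n + (Suc n choose 2)"
    by (simp add: numeral_2_eq_2)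
  then have "(1 - x ^ k) * q ^ (Suc (Suc n) choose 2)
      = q ^ Suc n * ((1 - x ^ k) * q ^ (Suc n choose 2))"
    by (simp add: power_add)
  also have "\<dots> = q ^ Suc n * (qpoch x q (k - n) * (- x) ^ n * qpoch (q / x) q n)"
    using Suc by simp
  also have "\<dots> = qpoch x q (k - Suc n) * (- x) ^ n * qpoch (q / x) q n *
      (q ^ Suc n * (1 - x * q ^ (k - Suc n)))"
    unfolding A by (simp only: mult_ac)
  also have "\<dots> = qpoch x q (k - Suc n) * (- x) ^ Suc n * qpoch (q / x) q (Suc n)"
    unfolding B by (simp add: qpoch_Suc)
  finally show ?case by simp
qed

lemma choose_two_double: "2 * (Suc n choose 2) = n * (n + 1)"
  by (induction n) (simp_all add: numeral_2_eq_2)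

text \<open>At \<open>n = k\<close> the reflection formula compares
  \<open>(- x) ^ k * (1 - (1 / x) ^ k)\<close> with \<open>1 - x ^ k\<close>, so that only a sign is
  left for the triangular power.\<close>

lemma primitive_root_choose_two:
  assumes "primitive_root k q"
  shows "(-1) ^ k * q ^ (k choose 2) = - 1"
proof -
  have q0: "q \<noteq> 0" using assms by (rule primitive_root_nonzero)
  have k: "k > 0" using assms by (rule primitive_root_pos)
  \<comment> \<open>The point 2 serves as a nonzero \<open>x\<close> off the unit circle, so that
    \<open>1 - x ^ k\<close> can be cancelled.\<close>
  have "qpoch 2 q (k - k) * (- 2) ^ k * qpoch (q / 2) q k = (1 - 2 ^ k) * q ^ (Suc k choose 2)"
    using assms by (intro qpoch_reflect) auto
  moreover have "q ^ (Suc k choose 2) = q ^ (k choose 2)"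
    using primitive_root_power[OF assms] by (simp add: numeral_2_eq_2 power_add)
  ultimately have "(- 2) ^ k * (1 - (1 / 2) ^ k) = (1 - 2 ^ k) * q ^ (k choose 2)"
    using primitive_root_power[OF assms] by (simp add: qpoch_full[OF assms] power_divide)
  moreover have "(- 2) ^ k = (- 1) ^ k * (2 ^ k :: complex)" by (simp flip: power_mult_distrib)
  moreover have "2 ^ k * (1 - (1 / 2) ^ k) = (2 ^ k - 1 :: complex)"
    by (simp add: power_divide right_diff_distrib)
  ultimately have "(- 1) ^ k * (2 ^ k - 1) = (1 - 2 ^ k) * q ^ (k choose 2)"
    by (simp only: mult.assoc)
  then have "(1 - 2 ^ k) * ((- 1) ^ k + q ^ (k choose 2)) = 0" by (simp add: algebra_simps)
  moreover have "(2 ^ k :: complex) \<noteq> 1"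
  proof
    assume "(2 ^ k :: complex) = 1"
    then have "norm (2 ^ k :: complex) = 1" by simp
    then have "(2 :: real) ^ k = 1" by (simp only: norm_power norm_numeral)
    then show False using one_less_power[of "2 :: real" k] k by simp
  qed
  ultimately have "q ^ (k choose 2) = - ((- 1) ^ k)" by (simp add: add_eq_0_iff)
  then show ?thesis by simp
qed

text \<open>Along each residue class modulo \<open>k\<close> the series is geometric with ratio
  \<open>c\<close>.\<close>

lemma sums_geometric_period:
  fixes f :: "nat \<Rightarrow> 'a :: {real_normed_field, banach}"
  assumes "k > 0" "\<And>n. f (n + k) = c * f n" "norm c < 1"
  shows "f sums ((\<Sum>n<k. f n) / (1 - c))"
proof -
  \<comment> \<open>\<open>g r\<close> is \<open>f\<close> restricted to the indices congruent to
    \<open>r\<close>, so the \<open>g r\<close> with \<open>r < k\<close> add up to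
    \<open>f\<close>.\<close>
  define g where "g = (\<lambda>r n. if n mod k = r then f n else 0)"
  have f: "f (r + j * k) = f r * c ^ j" for r j
  proof (induction j)
    case (Suc j)
    have "f (r + Suc j * k) = c * f (r + j * k)"
      using assms(2)[of "r + j * k"] by (simp add: algebra_simps)
    then show ?case using Suc by simp
  qed simp
  have "g r sums (f r / (1 - c))" if "r < k" for r
  proof -
    have "strict_mono (\<lambda>j. r + j * k)"
      using \<open>k > 0\<close> by (auto simp: strict_mono_def)
    moreover have "g r n = 0" if "n \<notin> range (\<lambda>j. r + j * k)" for n
    proof (rule ccontr)
      assume "g r n \<noteq> 0"
      then have "n mod k = r" by (auto simp: g_def split: if_splits)
      then have "n = r + (n div k) * k" by (metis mod_div_mult_eq)
      then show False using that by blast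
    qed
    moreover have "(\<lambda>j. g r (r + j * k)) sums (f r / (1 - c))"
      using sums_mult[OF geometric_sums[OF assms(3)], of "f r"] \<open>r < k\<close>
      by (simp add: g_def f)
    ultimately show ?thesis using sums_mono_reindex by blast
  qed
  then have "(\<lambda>n. \<Sum>r<k. g r n) sums (\<Sum>r<k. f r / (1 - c))"
    by (intro sums_sum) auto
  moreover have "(\<lambda>n. \<Sum>r<k. g r n) = f"
    using \<open>k > 0\<close> by (auto simp: g_def fun_eq_iff)
  ultimately show ?thesis by (simp add: sum_divide_distrib)
qed

section \<open>Two families of sums over a period\<close>

text \<open>One period of Fine's series F(a, b; t), the sum of (aq)_n t^n / (bq)_n, at b = 0 and aq
  = x.\<close>

definition fine_sum :: "nat \<Rightarrow> complex \<Rightarrow> complex \<Rightarrow> complex \<Rightarrow> complex" where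
  "fine_sum k q x t = (\<Sum>n<k. qpoch x q n * t ^ n)"

text \<open>Telescope \<open>qpoch x q n * t ^ n\<close>; the boundary terms come from
  \<open>qpoch_full\<close>, and splitting off the first factor moves \<open>x\<close> to
  \<open>x * q\<close>.\<close>

lemma fine_sum_step:
  assumes "primitive_root k q"
  shows "fine_sum k q x t = 1 - (1 - x ^ k) * t ^ k + (1 - x) * t * fine_sum k q (x * q) t"
proof -
  have "(1 - x ^ k) * t ^ k - 1 = (\<Sum>n<k. qpoch x q (Suc n) * t ^ Suc n - qpoch x q n * t ^ n)"
    by (subst sum_lessThan_telescope) (simp add: qpoch_full[OF assms])
  also have "\<dots> = (\<Sum>n<k. qpoch x q (Suc n) * t ^ Suc n) - fine_sum k q x t"
    by (simp add: fine_sum_def sum_subtractf)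
  also have "(\<Sum>n<k. qpoch x q (Suc n) * t ^ Suc n) = (1 - x) * t * fine_sum k q (x * q) t"
    unfolding fine_sum_def sum_distrib_left
  proof (intro sum.cong refl)
    fix n
    show "qpoch x q (Suc n) * t ^ Suc n = (1 - x) * t * (qpoch (x * q) q n * t ^ n)"
      using qpoch_shift[of x q n] by (simp add: qpoch_Suc)
  qed
  finally show ?thesis by (simp add: algebra_simps)
qed

text \<open>By \<open>qpoch_shift\<close> the sum at \<open>x * q\<close> has an extra factor
  \<open>1 - x * q ^ n\<close>, and \<open>q ^ n\<close> is absorbed into \<open>t ^ n\<close>. The
  recurrence in \<open>x\<close> thus becomes one in \<open>t\<close>.\<close>

lemma fine_sum_step':
  assumes "primitive_root k q"
  shows "(1 - t) * fine_sum k q x t = 1 - (1 - x ^ k) * t ^ k - x * t * fine_sum k q x (t * q)"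
proof -
  have "(1 - x) * t * fine_sum k q (x * q) t = (\<Sum>n<k. t * (((1 - x) * qpoch (x * q) q n) * t ^ n))"
    by (simp add: fine_sum_def sum_distrib_left mult_ac)
  also have "\<dots> = (\<Sum>n<k. t * (qpoch x q n * t ^ n) - x * t * (qpoch x q n * (t * q) ^ n))"
    unfolding qpoch_shift by (intro sum.cong refl) (simp add: algebra_simps power_mult_distrib)
  also have "\<dots> = t * fine_sum k q x t - x * t * fine_sum k q x (t * q)"
    by (simp add: fine_sum_def sum_subtractf sum_distrib_left)
  finally have "(1 - x) * t * fine_sum k q (x * q) t
    = t * fine_sum k q x t - x * t * fine_sum k q x (t * q)" .
  moreover have "(1 - t) * G = c - e" if "G = c + d" "d = t * G - e" for G c d e :: complex
    using that by algebra
  ultimately show ?thesis using fine_sum_step[OF assms, of x t] by blast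
qed

text \<open>One step in each parameter, in opposite directions, keeps the product
  \<open>x * t\<close> fixed. The constant 3 is the boundary term
  \<open>1 - (1 - x ^ k) * t ^ k\<close>.\<close>

lemma fine_sum_antidiagonal:
  assumes "primitive_root k q" "x ^ k = -1" "t ^ k = -1"
  shows "(1 - x) * (1 - t / q) * fine_sum k q (x * q) (t / q) = 3 - x * fine_sum k q x t"
proof -
  have q: "q \<noteq> 0" "q ^ k = 1"
    using assms by (auto dest: primitive_root_nonzero primitive_root_power)
  have t: "t \<noteq> 0" using assms primitive_root_pos[OF assms(1)] by (auto simp: power_0_left)
  have M: "(1 - x) * t * fine_sum k q (x * q) t = fine_sum k q x t - 3"
    using fine_sum_step[OF assms(1), of x t] assms by (simp add: algebra_simps)
  have "(1 - t / q) * fine_sum k q (x * q) (t / q) = 3 - x * (t * fine_sum k q (x * q) t)"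
    using fine_sum_step'[OF assms(1), of "t / q" "x * q"] q assms
    by (simp add: power_divide power_mult_distrib)
  then have "(1 - x) * ((1 - t / q) * fine_sum k q (x * q) (t / q))
     = (1 - x) * (3 - x * (t * fine_sum k q (x * q) t))"
    by simp
  also have "\<dots> = 3 * (1 - x) - x * ((1 - x) * t * fine_sum k q (x * q) t)"
    by (simp add: algebra_simps)
  also have "\<dots> = 3 - x * fine_sum k q x t"
    unfolding M by (simp add: algebra_simps)
  finally show ?thesis by (simp only: mult.assoc)
qed

text \<open>Unroll the recurrence in \<open>t\<close>. After \<open>k\<close> steps \<open>t\<close>
  is back where it was and the remainder is -1/2 times the sum itself, so F = 3 S - F / 2, which is
  solved for F.\<close>

lemma fine_sum_eq:
  assumes "primitive_root k q" "x ^ k = -1" "t ^ k = -1"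
  shows "fine_sum k q x t = 2 * (\<Sum>n<k. (- x * t) ^ n * q ^ (n choose 2) / qpoch t q (Suc n))"
proof -
  have k: "k > 0" and q: "q ^ k = 1"
    using assms by (auto intro: primitive_root_pos primitive_root_power)
  have nz: "qpoch t q n \<noteq> 0" for n
    using assms(3) by (intro qpoch_nonzero[OF q]) simp
  have iter: "fine_sum k q x t = 3 * (\<Sum>n<N. (- x * t) ^ n * q ^ (n choose 2) / qpoch t q (Suc n))
     + (- x * t) ^ N * q ^ (N choose 2) / qpoch t q N * fine_sum k q x (t * q ^ N)" for N
  proof (induction N)
    case (Suc N)
    define S where "S = (\<Sum>n<N. (- x * t) ^ n * q ^ (n choose 2) / qpoch t q (Suc n))"
    define B where "B = (- x * t) ^ N * q ^ (N choose 2)"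
    define P where "P = qpoch t q N"
    define u where "u = 1 - t * q ^ N"
    define G where "G = fine_sum k q x (t * q ^ N)"
    define H where "H = fine_sum k q x (t * q ^ Suc N)"
    have "(t * q ^ N) ^ k = -1"
      using q assms(3) by (simp add: power_mult_distrib) (metis power_mult mult.commute power_one)
    then have uG: "u * G = 3 - x * (t * q ^ N) * H"
      using fine_sum_step'[OF assms(1), of "t * q ^ N" x] assms(2)
      by (simp add: G_def H_def u_def mult_ac)
    have PS: "qpoch t q (Suc N) = P * u"
      by (simp add: qpoch_Suc P_def u_def)
    then have nz': "P \<noteq> 0" "u \<noteq> 0" using nz[of "Suc N"] by auto
    have BS: "(- x * t) ^ Suc N * q ^ (Suc N choose 2) = - x * (t * q ^ N) * B"
      by (simp add: B_def numeral_2_eq_2 power_add)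
    have "fine_sum k q x t = 3 * S + B / P * G"
      using Suc.IH by (simp only: S_def B_def P_def G_def)
    also have "B / P * G = B / (P * u) * (u * G)"
      using nz' by simp
    also have "\<dots> = 3 * (B / (P * u)) + (- x * (t * q ^ N) * B) / (P * u) * H"
      unfolding uG using nz' by (simp add: right_diff_distrib mult_ac)
    finally show ?case
      unfolding sum.lessThan_Suc PS BS S_def[symmetric] B_def[symmetric] H_def[symmetric]
      by (simp add: distrib_left)
  qed (simp add: numeral_2_eq_2)
  define S where "S = (\<Sum>n<k. (- x * t) ^ n * q ^ (n choose 2) / qpoch t q (Suc n))"
  \<comment> \<open>The sign \<open>(- 1) ^ k\<close> is the one in
    \<open>primitive_root_choose_two\<close>, so the parity of \<open>k\<close> does not
    matter.\<close>
  have "(- x * t) ^ k = (- 1) ^ k * (x ^ k * t ^ k)"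
    by (simp flip: power_mult_distrib)
  then have "(- x * t) ^ k * q ^ (k choose 2) = -1"
    using assms primitive_root_choose_two[OF assms(1)] by simp
  then have "fine_sum k q x t = 3 * S - fine_sum k q x t / 2"
    using iter[of k] q assms(3) by (simp add: qpoch_full[OF assms(1)] S_def)
  then show ?thesis by (simp add: S_def field_simps)
qed

text \<open>One period of the basic hypergeometric series 3phi2 with upper parameters a, b, q, lower
  parameters 0, 0 and argument q.\<close>

definition heine_sum :: "nat \<Rightarrow> complex \<Rightarrow> complex \<Rightarrow> complex \<Rightarrow> complex" where
  "heine_sum k q a b = (\<Sum>n<k. q ^ n * qpoch a q n * qpoch b q n)"

lemma heine_sum_commute: "heine_sum k q a b = heine_sum k q b a"
  by (simp add: heine_sum_def mult_ac)

text \<open>Telescope (a)_n (b)_n using (1 - a y)(1 - b y) - 1 = -a y - b y (1 - a y) at y = q^n;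
  the factor 1 - a y moves \<open>a\<close> to \<open>a * q\<close>.\<close>

lemma heine_sum_step:
  assumes "primitive_root k q"
  shows "b * (1 - a) * heine_sum k q (a * q) b
      = - ((1 - a ^ k) * (1 - b ^ k) - 1 + a * heine_sum k q a b)"
proof -
  define P where "P n = qpoch a q n * qpoch b q n" for n
  have "(1 - a ^ k) * (1 - b ^ k) - 1 = (\<Sum>n<k. P (Suc n) - P n)"
    by (subst sum_lessThan_telescope) (simp add: qpoch_full[OF assms] P_def)
  also have "\<dots> = (\<Sum>n<k. - a * (q ^ n * P n) - b * (P n * (1 - a * q ^ n) * q ^ n))"
    by (intro sum.cong refl) (simp add: P_def qpoch_Suc algebra_simps)
  also have "\<dots> = - a * heine_sum k q a b - (\<Sum>n<k. b * (P n * (1 - a * q ^ n) * q ^ n))"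
    by (simp add: sum_subtractf heine_sum_def P_def sum_distrib_left mult_ac sum_negf)
  also have "(\<Sum>n<k. b * (P n * (1 - a * q ^ n) * q ^ n)) = b * (1 - a) * heine_sum k q (a * q) b"
    unfolding heine_sum_def sum_distrib_left
  proof (intro sum.cong refl)
    fix n
    have "b * (P n * (1 - a * q ^ n) * q ^ n) = b * (qpoch a q n * (1 - a * q ^ n)) * q ^ n * qpoch b q n"
      by (simp only: P_def mult_ac)
    also have "\<dots> = b * (1 - a) * (q ^ n * qpoch (a * q) q n * qpoch b q n)"
      unfolding qpoch_shift[symmetric] by (simp only: mult_ac)
    finally show "b * (P n * (1 - a * q ^ n) * q ^ n) = \<dots>" .
  qed
  finally show ?thesis by (simp add: algebra_simps)
qed

section \<open>Base change between the two families\<close>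

text \<open>Two steps of \<open>heine_sum\<close> in base \<open>q\<close> match one antidiagonal
  step of \<open>fine_sum\<close> in base \<open>q\<^sup>2\<close>. The constants cancel in the
  difference \<open>D\<close>, and a full turn of \<open>k\<close> steps gives
  \<open>4 * D a = D a\<close>.\<close>

lemma heine_sum_eq_fine_sum_odd:
  assumes "primitive_root k q" "odd k" "a ^ k = -1"
  shows "heine_sum k q a (- q) = - fine_sum k (q\<^sup>2) a (q / a) / a"
proof -
  have k: "k > 0" and qk: "q ^ k = 1" and q0: "q \<noteq> 0"
    using assms by (auto dest: primitive_root_pos primitive_root_power primitive_root_nonzero)
  have q2: "primitive_root k (q\<^sup>2)"
    using assms by (intro primitive_root_power_coprime) auto
  define D where "D x = heine_sum k q x (- q) + fine_sum k (q\<^sup>2) x (q / x) / x" for x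
  have step: "q * ((1 - x) * (1 - x * q)) * D (x * q\<^sup>2) = x\<^sup>2 * D x" if x: "x ^ k = -1" for x
  proof -
    have x0: "x \<noteq> 0" using x k by (auto simp: power_0_left)
    have h: "q * (1 - y) * heine_sum k q (y * q) (- q) = 3 + y * heine_sum k q y (- q)"
      if "y ^ k = -1" for y
    proof -
      have "- (q * (1 - y) * heine_sum k q (y * q) (- q)) = - (3 + y * heine_sum k q y (- q))"
        using heine_sum_step[OF assms(1), of "- q" y] that qk \<open>odd k\<close>
        by (simp add: power_minus_odd)
      then show ?thesis by (simp only: neg_equal_iff_equal)
    qed
    have h1: "q * (1 - x) * heine_sum k q (x * q) (- q) = 3 + x * heine_sum k q x (- q)"
      using x by (rule h)
    have h2: "q * (1 - x * q) * heine_sum k q (x * q\<^sup>2) (- q)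
        = 3 + x * q * heine_sum k q (x * q) (- q)"
      using h[of "x * q"] x qk by (simp add: power_mult_distrib power2_eq_square mult_ac)
    \<comment> \<open>Eliminating the middle value at \<open>x * q\<close> leaves the constant 3 (1
      - x) + 3 x = 3.\<close>
    have H: "q * ((1 - x) * (1 - x * q)) * heine_sum k q (x * q\<^sup>2) (- q)
        = 3 + x\<^sup>2 * heine_sum k q x (- q)"
      using h1 h2 q0 by algebra
    have "(1 - x) * (1 - q / x / q\<^sup>2) * fine_sum k (q\<^sup>2) (x * q\<^sup>2) (q / x / q\<^sup>2)
        = 3 - x * fine_sum k (q\<^sup>2) x (q / x)"
      using x qk by (intro fine_sum_antidiagonal[OF q2]) (simp_all add: power_divide)
    moreover have "q / x / q\<^sup>2 = q / (x * q\<^sup>2)" by simp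
    ultimately have "(1 - x) * (1 - q / (x * q\<^sup>2)) * fine_sum k (q\<^sup>2) (x * q\<^sup>2) (q / (x * q\<^sup>2))
        = 3 - x * fine_sum k (q\<^sup>2) x (q / x)" by simp
    moreover have "q * ((1 - x) * (1 - x * q)) * (f / (x * q\<^sup>2))
        = - ((1 - x) * (1 - q / (x * q\<^sup>2)) * f)" for f
      using x0 q0 by (simp add: field_simps power2_eq_square)
    ultimately have F: "q * ((1 - x) * (1 - x * q)) * (fine_sum k (q\<^sup>2) (x * q\<^sup>2) (q / (x * q\<^sup>2)) / (x * q\<^sup>2))
        = - 3 + x\<^sup>2 * (fine_sum k (q\<^sup>2) x (q / x) / x)"
      using x0 by (simp add: power2_eq_square)
    show ?thesis
      using H F by (simp only: D_def distrib_left) simp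
  qed
  have iter: "q ^ N * qpoch a (q\<^sup>2) N * qpoch (a * q) (q\<^sup>2) N * D (a * q ^ (2 * N))
      = a ^ (2 * N) * (q ^ 4) ^ (N choose 2) * D a" for N
  proof (induction N)
    case (Suc N)
    have "(a * q ^ (2 * N)) ^ k = -1"
      using qk assms(3) by (simp add: power_mult_distrib) (metis power_mult mult.commute power_one)
    note st = step[OF this]
    have "q ^ Suc N * qpoch a (q\<^sup>2) (Suc N) * qpoch (a * q) (q\<^sup>2) (Suc N) * D (a * q ^ (2 * Suc N))
       = q ^ N * qpoch a (q\<^sup>2) N * qpoch (a * q) (q\<^sup>2) N *
         (q * ((1 - a * q ^ (2 * N)) * (1 - a * q ^ (2 * N) * q)) * D (a * q ^ (2 * N) * q\<^sup>2))"
      by (simp add: qpoch_Suc power_mult power2_eq_square power_mult_distrib mult_ac)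
    also have "\<dots> = (a * q ^ (2 * N))\<^sup>2 *
        (q ^ N * qpoch a (q\<^sup>2) N * qpoch (a * q) (q\<^sup>2) N * D (a * q ^ (2 * N)))"
      unfolding st by (simp only: mult_ac)
    also have "\<dots> = a ^ (2 * Suc N) * (q ^ 4) ^ (Suc N choose 2) * D a"
    proof -
      have "(q ^ 4) ^ (Suc N choose 2) = (q ^ (2 * N))\<^sup>2 * (q ^ 4) ^ (N choose 2)"
      proof -
        have "(q ^ 4) ^ N = (q ^ (2 * N))\<^sup>2" by (simp add: mult.commute flip: power_mult)
        then show ?thesis by (simp only: choose_two_Suc power_add)
      qed
      then show ?thesis unfolding Suc.IH by (simp add: power_mult_distrib power2_eq_square mult_ac)
    qed
    finally show ?case .
  qed (simp add: numeral_2_eq_2)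
  \<comment> \<open>From \<open>2 * (k choose 2) = (k - 1) * k\<close>, as 2 is coprime to the odd
    number \<open>k\<close>.\<close>
  have "k dvd (k choose 2)"
    using \<open>odd k\<close> choose_two_double[of "k - 1"] k
    by (metis coprime_commute coprime_dvd_mult_right_iff coprime_right_2_iff_odd dvd_triv_right Suc_diff_1 Suc_eq_plus1)
  then have "(q ^ 4) ^ (k choose 2) = 1"
    using qk by (metis dvdE power_mult power_one mult.commute)
  moreover have "a ^ (2 * k) = 1" "q ^ (2 * k) = 1"
    using assms(3) qk by (simp_all add: power_mult mult.commute[of 2])
  ultimately have "4 * D a = D a"
    using iter[of k] qk assms(3) by (simp add: qpoch_full[OF q2] power_mult_distrib)
  then have "D a = 0" by simp
  then show ?thesis by (simp add: D_def eq_neg_iff_add_eq_0)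
qed

text \<open>Moving \<open>x\<close> to \<open>x * q\<^sup>2\<close> is an antidiagonal step in base
  \<open>q\<^sup>2\<close> and a single step of \<open>x\<^sup>2\<close> in base
  \<open>q ^ 4\<close>; the factors agree because (1 - x)(1 + 1/x) = (1 - x^2)/x. The turn has
  \<open>2 * l\<close> steps, two periods of base \<open>q ^ 4\<close>, so the product over it is 2
  * 2 and again \<open>4 * D x = D x\<close>.\<close>

lemma heine_sum_eq_fine_sum_even:
  assumes "primitive_root (4 * l) q" "x ^ (2 * l) = -1"
  shows "fine_sum (2 * l) (q\<^sup>2) x (- (q\<^sup>2) / x) = - x * heine_sum l (q ^ 4) (x\<^sup>2) (q\<^sup>2)"
proof -
  have l: "l > 0" and qk: "q ^ (4 * l) = 1" and q0: "q \<noteq> 0"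
    using assms by (auto dest: primitive_root_pos primitive_root_power primitive_root_nonzero)
  have q2: "primitive_root (2 * l) (q\<^sup>2)" and q4: "primitive_root l (q ^ 4)"
    by (rule primitive_root_power_div[OF assms(1)]; simp)+
  have half: "q ^ (2 * l) = -1"
    by (rule primitive_root_half) (use assms(1) in simp)
  define D where "D x = fine_sum (2 * l) (q\<^sup>2) x (- (q\<^sup>2) / x) + x * heine_sum l (q ^ 4) (x\<^sup>2) (q\<^sup>2)" for x
  have step: "(1 - x\<^sup>2) * D (x * q\<^sup>2) = - x\<^sup>2 * D x" if x: "x ^ (2 * l) = -1" for x
  proof -
    have x0: "x \<noteq> 0" using x l by (auto simp: power_0_left)
    have "(- (q\<^sup>2) / x) ^ (2 * l) = -1"
      using x qk by (simp add: power_divide flip: power_mult)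
    then have "(1 - x) * (1 - - (q\<^sup>2) / x / q\<^sup>2) * fine_sum (2 * l) (q\<^sup>2) (x * q\<^sup>2) (- (q\<^sup>2) / x / q\<^sup>2)
        = 3 - x * fine_sum (2 * l) (q\<^sup>2) x (- (q\<^sup>2) / x)"
      using x by (intro fine_sum_antidiagonal[OF q2])
    moreover have "- (q\<^sup>2) / x / q\<^sup>2 = - (q\<^sup>2) / (x * q\<^sup>2)" "1 - - (q\<^sup>2) / x / q\<^sup>2 = (1 + x) / x"
      using q0 x0 by (simp_all add: field_simps)
    ultimately have E: "(1 - x) * ((1 + x) / x) * fine_sum (2 * l) (q\<^sup>2) (x * q\<^sup>2) (- (q\<^sup>2) / (x * q\<^sup>2))
        = 3 - x * fine_sum (2 * l) (q\<^sup>2) x (- (q\<^sup>2) / x)" by simp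
    have F: "(1 - x\<^sup>2) * fine_sum (2 * l) (q\<^sup>2) (x * q\<^sup>2) (- (q\<^sup>2) / (x * q\<^sup>2))
        = x * (3 - x * fine_sum (2 * l) (q\<^sup>2) x (- (q\<^sup>2) / x))"
    proof -
      have *: "(1 - x\<^sup>2) * f = x * ((1 - x) * ((1 + x) / x) * f)" for f
        using x0 by (simp add: power2_eq_square field_simps)
      show ?thesis unfolding * E ..
    qed
    have "(x\<^sup>2) ^ l = -1" "(q\<^sup>2) ^ l = -1" using x half by (simp_all flip: power_mult)
    then have H: "q\<^sup>2 * (1 - x\<^sup>2) * heine_sum l (q ^ 4) ((x * q\<^sup>2)\<^sup>2) (q\<^sup>2)
        = - (3 + x\<^sup>2 * heine_sum l (q ^ 4) (x\<^sup>2) (q\<^sup>2))"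
      using heine_sum_step[OF q4, of "q\<^sup>2" "x\<^sup>2"]
      by (simp add: power_mult_distrib flip: power_mult)
    show ?thesis
      unfolding D_def using F H by algebra
  qed
  have iter: "qpoch (x\<^sup>2) (q ^ 4) N * D (x * q ^ (2 * N))
      = (- 1) ^ N * x ^ (2 * N) * (q ^ 4) ^ (N choose 2) * D x" for N
  proof (induction N)
    case (Suc N)
    have "(x * q ^ (2 * N)) ^ (2 * l) = -1"
      using half assms(2) by (simp add: power_mult_distrib) (metis power_mult mult.commute power_one mult_minus1 minus_minus power2_minus one_power2)
    note st = step[OF this]
    have sq: "(x * q ^ (2 * N))\<^sup>2 = x\<^sup>2 * (q ^ 4) ^ N"
      by (simp add: power_mult_distrib mult.commute flip: power_mult)
    have "qpoch (x\<^sup>2) (q ^ 4) (Suc N) * D (x * q ^ (2 * Suc N))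
       = qpoch (x\<^sup>2) (q ^ 4) N * ((1 - (x * q ^ (2 * N))\<^sup>2) * D (x * q ^ (2 * N) * q\<^sup>2))"
      unfolding sq by (simp add: qpoch_Suc power_add mult_ac power2_eq_square)
    also have "\<dots> = - (x * q ^ (2 * N))\<^sup>2 * (qpoch (x\<^sup>2) (q ^ 4) N * D (x * q ^ (2 * N)))"
      unfolding st by (simp only: mult_ac)
    also have "\<dots> = (- 1) ^ Suc N * x ^ (2 * Suc N) * (q ^ 4) ^ (Suc N choose 2) * D x"
      unfolding Suc.IH sq by (simp add: numeral_2_eq_2 power_add mult_ac)
    finally show ?case .
  qed (simp add: numeral_2_eq_2)
  \<comment> \<open>The exponent 4 l (2l - 1) is regrouped as an even multiple of
    \<open>2 * l\<close>, and \<open>q ^ (2 * l)\<close> is -1.\<close>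
  have "(q ^ 4) ^ (2 * l choose 2) = (q ^ (2 * l)) ^ (2 * (2 * l - 1))"
  proof -
    have "2 * (2 * l choose 2) = 2 * l * (2 * l - 1)"
      using choose_two_double[of "2 * l - 1"] l by simp
    then have "4 * (2 * l choose 2) = 2 * l * (2 * (2 * l - 1))" by simp
    then show ?thesis by (simp only: power_mult[symmetric])
  qed
  then have "(q ^ 4) ^ (2 * l choose 2) = (- 1) ^ (2 * (2 * l - 1))" unfolding half .
  then have "(q ^ 4) ^ (2 * l choose 2) = 1" by simp
  moreover have "x ^ (2 * (2 * l)) = 1"
    using assms(2) by (metis power_mult mult.commute power2_minus one_power2)
  moreover have "(x\<^sup>2) ^ l = -1" using assms(2) by (simp flip: power_mult)
  then have "qpoch (x\<^sup>2) (q ^ 4) (2 * l) = 4"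
    using qpoch_period[OF q4, of "x\<^sup>2" l] by (simp add: qpoch_full[OF q4] mult_2)
  moreover have "q ^ (2 * (2 * l)) = 1" using qk by simp
  ultimately have "4 * D x = D x"
    using iter[of "2 * l"] by (simp add: power_mult)
  then have "D x = 0" by simp
  then show ?thesis by (simp add: D_def eq_neg_iff_add_eq_0)
qed

section \<open>Trisection and reversal\<close>

text \<open>The sums at (a, q/a) and at (aq, 1/a) both step to the one at (aq, q/a), the first
  through its first parameter, the second through its second. The common value is eliminated
  together with its factor \<open>1 - a\<close>, so \<open>a = 1\<close> is allowed.\<close>

lemma heine_sum_reflected_step:
  assumes "primitive_root k q" "a \<noteq> 0"
  shows "heine_sum k q (a * q) (q / (a * q))
    = - ((1 - a ^ k) * (1 - inverse a ^ k) - 1) * (a + a\<^sup>2) - a ^ 3 * heine_sum k q a (q / a)"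
proof -
  have q0: "q \<noteq> 0" and qk: "q ^ k = 1"
    using assms by (auto dest: primitive_root_power primitive_root_nonzero)
  define c where "c = (1 - a ^ k) * (1 - inverse a ^ k) - 1"
  define V where "V = heine_sum k q a (q / a)"
  define V' where "V' = heine_sum k q (a * q) (q / (a * q))"
  define T where "T = heine_sum k q (a * q) (q / a)"
  have "q / a * (1 - a) * T = - (c + a * V)"
    using heine_sum_step[OF assms(1), of "q / a" a] qk
    by (simp add: T_def V_def c_def power_divide power_inverse divide_inverse power_mult_distrib)
  then have 1: "q * (1 - a) * T = - a * (c + a * V)"
    using assms(2) by (simp add: field_simps)
  have eq: "inverse a * q = q / a" "q / (a * q) = inverse a"
    using q0 assms(2) by (simp_all add: field_simps)
  have "a * q * (1 - inverse a) * T = - (c + inverse a * V')"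
    using heine_sum_step[OF assms(1), of "a * q" "inverse a"] qk
    unfolding T_def V'_def c_def eq heine_sum_commute[of k q "q / a" "a * q"]
      heine_sum_commute[of k q "inverse a" "a * q"]
    by (simp add: power_mult_distrib mult.commute)
  moreover have "a * q * (1 - inverse a) = - (q * (1 - a))"
    using assms(2) by (simp add: field_simps)
  ultimately have "- (q * (1 - a) * T) = - (c + inverse a * V')" by simp
  then have "c + inverse a * V' = - a * (c + a * V)"
    unfolding 1 by (simp only: neg_equal_iff_equal)
  then have "a * (c + inverse a * V') = a * (- a * (c + a * V))" by simp
  then have "V' = - c * (a + a\<^sup>2) - a ^ 3 * V"
  proof -
    have "a * (inverse a * V') = V'" using assms(2) by simp
    moreover have "v = - c * (a + a\<^sup>2) - a ^ 3 * V"
      if "a * u = v" "a * (c + u) = a * (- a * (c + a * V))" for u v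
    proof -
      have "a * u - (- c * (a + a\<^sup>2) - a ^ 3 * V) = a * (c + u) - a * (- a * (c + a * V))"
        by (simp add: algebra_simps power2_eq_square power3_eq_cube)
      then show ?thesis using that by simp
    qed
    ultimately show ?thesis
      using \<open>a * (c + inverse a * V') = a * (- a * (c + a * V))\<close> by blast
  qed
  then show ?thesis by (simp add: V_def V'_def c_def)
qed

lemma continuous_on_heine_sum [continuous_intros]:
  assumes "continuous_on A f" "continuous_on A g"
  shows "continuous_on A (\<lambda>x. heine_sum k q (f x) (g x))"
  unfolding heine_sum_def qpoch_def by (intro continuous_intros assms)

text \<open>Since \<open>3 dvd k\<close>, the three points share the constant \<open>c\<close> and
  the cube \<open>x ^ 3\<close>, and \<open>1 + w + w\<^sup>2 = 0\<close> kills the inhomogeneous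
  terms in the sum \<open>X\<close> of the three recurrences.\<close>

lemma heine_sum_trisection:
  assumes "primitive_root k q" "3 dvd k" "w\<^sup>2 + w + 1 = 0" "a \<noteq> 0"
  shows "heine_sum k q a (q / a) + heine_sum k q (w * a) (q / (w * a))
    + heine_sum k q (w\<^sup>2 * a) (q / (w\<^sup>2 * a)) = 0"
proof -
  have k: "k > 0" and qk: "q ^ k = 1" and q0: "q \<noteq> 0"
    using assms by (auto dest: primitive_root_pos primitive_root_power primitive_root_nonzero)
  have w3: "w ^ 3 = 1" using assms(3) by algebra
  have w0: "w \<noteq> 0" using w3 by (auto simp: power_0_left)
  have wk: "w ^ k = 1" using w3 \<open>3 dvd k\<close> by (metis dvdE power_mult power_one)
  define V where "V x = heine_sum k q x (q / x)" for x
  define X where "X x = V x + V (w * x) + V (w\<^sup>2 * x)" for x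
  have step: "X (x * q) = - (x ^ 3) * X x" if x0: "x \<noteq> 0" for x
  proof -
    define c where "c = (1 - x ^ k) * (1 - inverse x ^ k) - 1"
    have V: "V (u * x * q) = - c * (u * x + (u * x)\<^sup>2) - x ^ 3 * V (u * x)"
      if "u ^ k = 1" "u ^ 3 = 1" for u
    proof -
      have "u \<noteq> 0" using that by (auto simp: power_0_left)
      moreover have "inverse u ^ k = 1" using that by (simp add: power_inverse)
      ultimately show ?thesis
        using heine_sum_reflected_step[OF assms(1), of "u * x"] x0 that
        by (simp add: V_def c_def power_mult_distrib)
    qed
    have "(w\<^sup>2) ^ k = 1" "(w\<^sup>2) ^ 3 = 1"
      using wk w3 by (metis power_mult mult.commute power_one)+
    then have "X (x * q) = - c * (x + x\<^sup>2) - x ^ 3 * V x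
       + (- c * (w * x + (w * x)\<^sup>2) - x ^ 3 * V (w * x))
       + (- c * (w\<^sup>2 * x + (w\<^sup>2 * x)\<^sup>2) - x ^ 3 * V (w\<^sup>2 * x))"
      using V[of 1] V[of w] V[of "w\<^sup>2"] wk w3 by (simp add: X_def mult.assoc)
    then show ?thesis using assms(3) unfolding X_def by algebra
  qed
  have iter: "X (x * q ^ N) = (- 1) ^ N * x ^ (3 * N) * (q ^ 3) ^ (N choose 2) * X x"
    if x0: "x \<noteq> 0" for x N
  proof (induction N)
    case (Suc N)
    have "X (x * q ^ Suc N) = - ((x * q ^ N) ^ 3) * X (x * q ^ N)"
      using step[of "x * q ^ N"] x0 q0 by (simp add: mult_ac)
    moreover have "(x * q ^ N) ^ 3 = x ^ 3 * (q ^ 3) ^ N"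
      by (simp add: power_mult_distrib mult.commute flip: power_mult)
    ultimately show ?case
      unfolding Suc.IH by (simp add: numeral_2_eq_2 power_add mult_ac)
  qed (simp add: numeral_2_eq_2)
  have off_circle: "X x = 0" if x: "x \<noteq> 0" "norm x \<noteq> 1" for x
  proof (rule ccontr)
    assume "X x \<noteq> 0"
    \<comment> \<open>After \<open>k\<close> steps the argument is \<open>x\<close> again, while
      every other factor has modulus 1.\<close>
    have "norm (X x) = norm x ^ (3 * k) * norm (X x)"
      using iter[OF x(1), of k] qk primitive_root_norm[OF assms(1)]
      by (metis mult.right_neutral mult_1 norm_minus_cancel norm_mult norm_one norm_power power_one)
    then have "norm x ^ (3 * k) = 1" using \<open>X x \<noteq> 0\<close> by simp
    then show False using k x(2) power_eq_imp_eq_base[of "norm x" "3 * k" 1] by simp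
  qed
  have "X a = 0"
  proof (cases "norm a = 1")
    case True
    \<comment> \<open>Approach \<open>a\<close> radially from outside the unit circle, where
      \<open>X\<close> is already known to vanish.\<close>
    define s where "s n = a * of_real (1 + inverse (real (Suc n)))" for n
    have s1: "norm (s n) \<noteq> 1" and s0: "s n \<noteq> 0" for n
    proof -
      have "1 + inverse (real (Suc n)) > 1" by simp
      moreover have "norm (s n) = 1 + inverse (real (Suc n))"
        using True by (simp add: s_def norm_mult del: of_real_add)
      ultimately show "norm (s n) \<noteq> 1" "s n \<noteq> 0" by (simp_all, force)
    qed
    have "isCont X a"
    proof -
      have "continuous_on (- {0}) X"
        unfolding X_def V_def using w0 by (intro continuous_intros) auto
      then show ?thesis using assms(4) by (simp add: continuous_on_eq_continuous_at open_Compl)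
    qed
    moreover have "s \<longlonglongrightarrow> a * of_real (1 + 0)"
      unfolding s_def by (intro tendsto_intros LIMSEQ_inverse_real_of_nat)
    then have "s \<longlonglongrightarrow> a" by simp
    ultimately have "(\<lambda>n. X (s n)) \<longlonglongrightarrow> X a" by (rule isCont_tendsto_compose)
    then show ?thesis using off_circle[OF s0 s1] by (simp add: LIMSEQ_const_iff)
  qed (use off_circle assms(4) in blast)
  then show ?thesis by (simp add: X_def V_def)
qed

text \<open>The difference n(n+1) - m(m+1) = (n - m)(n + m + 1) is a multiple of
  \<open>k\<close>.\<close>

lemma power_reflect:
  assumes "q ^ k = 1" "Suc (n + m) = k"
  shows "q ^ (n * Suc n) = (q ^ (m * Suc m) :: 'a :: comm_monoid_mult)"
proof -
  have "n * Suc n + k * m = m * Suc m + k * n"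
    unfolding assms(2)[symmetric] by (simp add: algebra_simps)
  then have "q ^ (n * Suc n) * (q ^ k) ^ m = q ^ (m * Suc m) * (q ^ k) ^ n"
    by (simp only: power_add[symmetric] power_mult[symmetric])
  then show ?thesis using assms by simp
qed

text \<open>In the product of two reflections the signs cancel and the triangular powers combine to
  \<open>q ^ (n * Suc n)\<close>.\<close>

lemma qpoch_reflect_pair:
  assumes "primitive_root k q" "x \<noteq> 0" "y \<noteq> 0" "n \<le> k"
  shows "qpoch x q (k - n) * qpoch y q (k - n) * (x * y) ^ n * (qpoch (q / x) q n * qpoch (q / y) q n)
    = (1 - x ^ k) * (1 - y ^ k) * q ^ (n * Suc n)"
proof -
  have "q ^ (n * Suc n) = q ^ (Suc n choose 2) * q ^ (Suc n choose 2)"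
    using choose_two_double[of n] by (simp flip: power_add mult_2)
  moreover have "(x * y) ^ n = (- x) ^ n * (- y) ^ n" by (simp flip: power_mult_distrib)
  ultimately show ?thesis
    using arg_cong2[OF qpoch_reflect[OF assms(1,2,4)] qpoch_reflect[OF assms(1,3,4)], of "(*)"]
    by (simp only: mult_ac)
qed

text \<open>Put n = k - 1 - m. As q/a = b and q/b = a, reflection turns the two denominators into
  the numerators \<open>qpoch b q m\<close> and \<open>qpoch a q m\<close>; the 4 is
  \<open>(1 - a ^ k) * (1 - b ^ k)\<close>.\<close>

lemma heine_sum_reverse:
  assumes "primitive_root k q" "a * b = q" "a ^ k = -1"
  shows "(\<Sum>n<k. q ^ (n * Suc n) / (qpoch a q (Suc n) * qpoch b q (Suc n))) = heine_sum k q a b / 4"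
proof -
  have q0: "q \<noteq> 0" and qk: "q ^ k = 1"
    using assms by (auto dest: primitive_root_power primitive_root_nonzero)
  have ab: "a \<noteq> 0" "b \<noteq> 0" using q0 assms(2) by auto
  have "a ^ k * b ^ k = 1" using assms(2) qk by (simp flip: power_mult_distrib)
  then have bk: "b ^ k = -1" using assms(3) by (simp add: minus_equation_iff)
  have "(\<Sum>n<k. q ^ (n * Suc n) / (qpoch a q (Suc n) * qpoch b q (Suc n)))
      = (\<Sum>m<k. q ^ ((k - Suc m) * Suc (k - Suc m)) /
          (qpoch a q (Suc (k - Suc m)) * qpoch b q (Suc (k - Suc m))))"
    by (rule sum.nat_diff_reindex[symmetric])
  also have "\<dots> = (\<Sum>m<k. q ^ m * qpoch a q m * qpoch b q m / 4)"
  proof (intro sum.cong refl)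
    fix m assume "m \<in> {..<k}"
    then have m: "m < k" by simp
    then have sk: "Suc (k - Suc m) = k - m" by simp
    have e: "q ^ ((k - Suc m) * (k - m)) = q ^ (m * Suc m)"
      using power_reflect[OF qk, of "k - Suc m" m] m sk by simp
    have qa: "q / a = b" "q / b = a" using ab assms(2) by (auto simp: field_simps)
    have "qpoch a q (k - m) * qpoch b q (k - m) * (q ^ m * (qpoch b q m * qpoch a q m))
        = 4 * q ^ (m * Suc m)"
      using qpoch_reflect_pair[OF assms(1) ab, of m] m bk
      by (simp add: qa assms(2,3) mult.assoc)
    moreover have "qpoch a q (k - m) \<noteq> 0" "qpoch b q (k - m) \<noteq> 0"
      using assms(3) bk by (auto intro!: qpoch_nonzero[OF qk])
    ultimately show "q ^ ((k - Suc m) * Suc (k - Suc m)) /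
          (qpoch a q (Suc (k - Suc m)) * qpoch b q (Suc (k - Suc m))) = q ^ m * qpoch a q m * qpoch b q m / 4"
      unfolding sk e by (simp add: divide_simps mult_ac)
  qed
  finally show ?thesis by (simp add: heine_sum_def sum_divide_distrib)
qed

text \<open>The left side is one period of Dyson's rank generating function at \<open>x\<close>:
  \<open>x = -1\<close> gives f, and minus a primitive cube root of unity gives chi. Reversal uses
  the reflected pair with parameters \<open>x\<close> and \<open>1 / x\<close>, whose first factors
  are split off.\<close>

lemma rank_sum_reverse:
  assumes "primitive_root k q" "x ^ k = -1"
  shows "(\<Sum>n<k. q ^ (n\<^sup>2) / (qpoch (x * q) q n * qpoch (q / x) q n))
    = (1 - x) * (1 - 1 / x) / 4 * (q * heine_sum k q (x * q) (q / x))"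
proof -
  have k: "k > 0" and q0: "q \<noteq> 0" and qk: "q ^ k = 1"
    using assms by (auto dest: primitive_root_pos primitive_root_power primitive_root_nonzero)
  have x0: "x \<noteq> 0" using assms(2) k by (auto simp: power_0_left)
  have x1: "x \<noteq> 1" using assms(2) by auto
  have xk: "(1 / x) ^ k = -1" using assms(2) by (simp add: power_divide)
  define c where "c = (1 - x) * (1 - 1 / x)"
  have "(\<Sum>n<k. q ^ (n\<^sup>2) / (qpoch (x * q) q n * qpoch (q / x) q n))
      = (\<Sum>m<k. q ^ ((k - Suc m)\<^sup>2) / (qpoch (x * q) q (k - Suc m) * qpoch (q / x) q (k - Suc m)))"
    by (rule sum.nat_diff_reindex[symmetric])
  also have "\<dots> = (\<Sum>m<k. c / 4 * (q * (q ^ m * qpoch (x * q) q m * qpoch (q / x) q m)))"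
  proof (intro sum.cong refl)
    fix m assume "m \<in> {..<k}"
    then have m: "m < k" by simp
    define n where "n = k - Suc m"
    have n: "k - m = Suc n" "n + Suc m = k" using m by (simp_all add: n_def)
    \<comment> \<open>This is n^2 = (k - (m+1))^2 written without subtraction.\<close>
    have "n\<^sup>2 + k * (2 * Suc m) = k * k + (Suc m)\<^sup>2"
      unfolding n(2)[symmetric] by (simp add: power2_eq_square algebra_simps)
    then have "q ^ (n\<^sup>2) * (q ^ k) ^ (2 * Suc m) = (q ^ k) ^ k * q ^ ((Suc m)\<^sup>2)"
      by (simp only: power_add[symmetric] power_mult[symmetric])
    then have e: "q ^ (n\<^sup>2) = q ^ (m * Suc m) * (q * q ^ m)"
      using qk by (simp add: power2_eq_square power_add[symmetric] power_Suc[symmetric] del: power_Suc)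
         (simp add: algebra_simps)
    have s: "qpoch y q (Suc n) = (1 - y) * qpoch (y * q) q n" for y
      using qpoch_shift[of y q n] by (simp add: qpoch_Suc)
    have "c * (qpoch (x * q) q n * qpoch (q / x) q n) * (qpoch (q / x) q m * qpoch (x * q) q m)
        = 4 * q ^ (m * Suc m)"
      using qpoch_reflect_pair[OF assms(1) x0, of "1 / x" m] m xk assms(2) x0
      by (simp add: n s c_def mult_ac)
    moreover have "qpoch (x * q) q n \<noteq> 0" "qpoch (q / x) q n \<noteq> 0"
      using assms(2) xk qk by (auto intro!: qpoch_nonzero[OF qk] simp: power_mult_distrib power_divide)
    ultimately show "q ^ ((k - Suc m)\<^sup>2) / (qpoch (x * q) q (k - Suc m) * qpoch (q / x) q (k - Suc m))
        = c / 4 * (q * (q ^ m * qpoch (x * q) q m * qpoch (q / x) q m))"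
      unfolding n_def[symmetric] e by (simp add: divide_simps mult_ac)
  qed
  finally show ?thesis by (simp add: heine_sum_def sum_distrib_left c_def)
qed

section \<open>Odd order\<close>

lemma power_square_shift: "z ^ ((n + k)\<^sup>2) = z ^ (n\<^sup>2) * (z ^ k) ^ (2 * n + k)"
  for z :: "'a :: comm_monoid_mult"
proof -
  have "(n + k)\<^sup>2 = n\<^sup>2 + k * (2 * n + k)" by (simp add: power2_eq_square algebra_simps)
  then show ?thesis by (simp only: power_add power_mult)
qed

text \<open>Matches the square exponents of the mock theta series with the triangular ones in
  \<open>fine_sum_eq\<close>, applied in base \<open>z\<^sup>2\<close>.\<close>

lemma power_square_conv_choose: "z ^ (n\<^sup>2) = z ^ n * (z\<^sup>2) ^ (n choose 2)"
  for z :: "'a :: comm_monoid_mult"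
proof (cases n)
  case (Suc m)
  have "n\<^sup>2 = n + 2 * (n choose 2)"
    using choose_two_double[of m] unfolding Suc by (simp add: power2_eq_square choose_two_Suc)
  then show ?thesis by (simp add: power_add power_mult)
qed (simp add: numeral_2_eq_2)

lemma power_product_shift:
  "z ^ ((n + k) * Suc (n + k)) = z ^ (n * Suc n) * (z ^ k) ^ (2 * n + k + 1)"
  for z :: "'a :: comm_monoid_mult"
proof -
  have "(n + k) * Suc (n + k) = n * Suc n + k * (2 * n + k + 1)" by (simp add: algebra_simps)
  then show ?thesis by (simp only: power_add power_mult)
qed

text \<open>Applied below with ratio -1/2 or 1/4, so the sum over a period is multiplied by 2/3 or
  4/3.\<close>

lemma well_defined_series_period:
  assumes "k > 0" "\<And>n. den n \<noteq> 0" "\<And>n. trm (n + k) = c * trm n" "norm c < 1"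
  shows "well_defined_series den trm" "suminf trm = (\<Sum>n<k. trm n) / (1 - c)"
  using sums_geometric_period[of k trm c, OF assms(1,3,4)] assms(2)
  by (auto simp: well_defined_series_def sums_iff)

lemma primitive_cube_root_of_unity_exists:
  obtains w :: complex where "w\<^sup>2 + w + 1 = 0"
proof
  show "(Complex (- 1 / 2) (sqrt 3 / 2))\<^sup>2 + Complex (- 1 / 2) (sqrt 3 / 2) + 1 = 0"
    by (simp add: complex_eq_iff power2_eq_square)
qed

context
  fixes k :: nat and q :: complex
  assumes q: "primitive_root k q" and odd: "odd k"
begin

lemma odd_root_facts:
  shows "k > 0" "q ^ k = 1" "q \<noteq> 0" "(- q) ^ k = -1" "primitive_root k (q\<^sup>2)"
  using q odd by (auto dest: primitive_root_pos primitive_root_power primitive_root_nonzero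
      intro!: primitive_root_power_coprime)

text \<open>In \<open>fine_sum_eq\<close> at \<open>t = -1\<close> the leading 2 cancels the first
  factor 1 - t of each denominator.\<close>

lemma fine_sum_phi:
  "(\<Sum>n<k. (- q) ^ (n\<^sup>2) / qpoch (- (q\<^sup>2)) (q\<^sup>2) n) = fine_sum k (q\<^sup>2) (- q) (- 1)"
proof -
  have "fine_sum k (q\<^sup>2) (- q) (- 1)
      = 2 * (\<Sum>n<k. (- q) ^ n * (q\<^sup>2) ^ (n choose 2) / qpoch (- 1) (q\<^sup>2) (Suc n))"
    using fine_sum_eq[OF odd_root_facts(5), of "- q" "- 1"] odd_root_facts odd by simp
  also have "\<dots> = (\<Sum>n<k. (- q) ^ (n\<^sup>2) / qpoch (- (q\<^sup>2)) (q\<^sup>2) n)"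
    unfolding sum_distrib_left
  proof (intro sum.cong refl)
    fix n
    have "qpoch (- 1) (q\<^sup>2) (Suc n) = 2 * qpoch (- (q\<^sup>2)) (q\<^sup>2) n"
      using qpoch_shift[of "- 1" "q\<^sup>2" n] by (simp add: qpoch_Suc)
    then show "2 * ((- q) ^ n * (q\<^sup>2) ^ (n choose 2) / qpoch (- 1) (q\<^sup>2) (Suc n))
        = (- q) ^ (n\<^sup>2) / qpoch (- (q\<^sup>2)) (q\<^sup>2) n"
      by (simp add: power_square_conv_choose[of "- q"])
  qed
  finally show ?thesis ..
qed

text \<open>The same sum read backwards. Comparing both evaluations links companion series built on
  (-q^2; q^2)_n with those built on (-q; q^2)_n.\<close>

lemma fine_sum_phi_reverse:
  "(\<Sum>n<k. (- q) ^ (n\<^sup>2) / qpoch (- (q\<^sup>2)) (q\<^sup>2) n) = q * fine_sum k (q\<^sup>2) (- (q\<^sup>2)) (- q)"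
proof -
  have "(\<Sum>n<k. (- q) ^ (n\<^sup>2) / qpoch (- (q\<^sup>2)) (q\<^sup>2) n)
      = (\<Sum>m<k. (- q) ^ ((k - Suc m)\<^sup>2) / qpoch (- (q\<^sup>2)) (q\<^sup>2) (k - Suc m))"
    by (rule sum.nat_diff_reindex[symmetric])
  also have "\<dots> = (\<Sum>m<k. q * (qpoch (- (q\<^sup>2)) (q\<^sup>2) m * (- q) ^ m))"
  proof (intro sum.cong refl)
    fix m assume "m \<in> {..<k}"
    then have m: "m < k" by simp
    define n where "n = k - Suc m"
    have n: "k - m = Suc n" "n + Suc m = k" using m by (simp_all add: n_def)
    have "n\<^sup>2 + k * (2 * Suc m) = k * k + (Suc m)\<^sup>2"
      unfolding n(2)[symmetric] by (simp add: power2_eq_square algebra_simps)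
    then have "(- q) ^ (n\<^sup>2) * ((- q) ^ k) ^ (2 * Suc m) = ((- q) ^ k) ^ k * (- q) ^ ((Suc m)\<^sup>2)"
      by (simp only: power_add[symmetric] power_mult[symmetric])
    then have "(- q) ^ (n\<^sup>2) = - ((- q) ^ ((Suc m)\<^sup>2))"
      unfolding odd_root_facts(4) using odd by (simp add: power_mult)
    also have "\<dots> = q * (- q) ^ m * (q\<^sup>2) ^ (Suc m choose 2)"
      unfolding power_square_conv_choose[of "- q"] by simp
    finally have e: "(- q) ^ (n\<^sup>2) = q * (- q) ^ m * (q\<^sup>2) ^ (Suc m choose 2)" .
    have "qpoch (- 1) (q\<^sup>2) (Suc n) = 2 * qpoch (- (q\<^sup>2)) (q\<^sup>2) n"
      using qpoch_shift[of "- 1" "q\<^sup>2" n] by (simp add: qpoch_Suc)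
    then have "qpoch (- (q\<^sup>2)) (q\<^sup>2) n * qpoch (- (q\<^sup>2)) (q\<^sup>2) m = (q\<^sup>2) ^ (Suc m choose 2)"
      using qpoch_reflect[OF odd_root_facts(5), of "- 1" m] m odd by (simp add: n)
    moreover have "qpoch (- (q\<^sup>2)) (q\<^sup>2) n \<noteq> 0"
      using primitive_root_power[OF odd_root_facts(5)] odd
      by (intro qpoch_nonzero[of _ k]) (simp_all add: power_minus_odd)
    ultimately show "(- q) ^ ((k - Suc m)\<^sup>2) / qpoch (- (q\<^sup>2)) (q\<^sup>2) (k - Suc m)
        = q * (qpoch (- (q\<^sup>2)) (q\<^sup>2) m * (- q) ^ m)"
      unfolding n_def[symmetric] e by (simp add: divide_simps mult_ac)
  qed
  finally show ?thesis by (simp add: fine_sum_def sum_distrib_left)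
qed

lemma fine_sum_odd_eq:
  "q * fine_sum k (q\<^sup>2) (- (q\<^sup>2)) (- q) = fine_sum k (q\<^sup>2) (- q) (- 1)"
  using fine_sum_phi fine_sum_phi_reverse by simp

text \<open>One step of the recurrence in \<open>t\<close>, from -1 to
  \<open>- (q\<^sup>2)\<close>.\<close>

lemma fine_sum_odd_eq':
  "(\<Sum>n<k. qpoch (- q) (q\<^sup>2) n * (- 1) ^ n * q ^ (2 * n + 1)) = 3 - 2 * fine_sum k (q\<^sup>2) (- q) (- 1)"
proof -
  have "(\<Sum>n<k. qpoch (- q) (q\<^sup>2) n * (- 1) ^ n * q ^ (2 * n + 1)) = q * fine_sum k (q\<^sup>2) (- q) (- (q\<^sup>2))"
    unfolding fine_sum_def sum_distrib_left
    by (intro sum.cong refl) (simp add: power_mult power_minus[of "q\<^sup>2"])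
  then show ?thesis
    using fine_sum_step'[OF odd_root_facts(5), of "- 1" "- q"] odd_root_facts odd by (simp add: algebra_simps)
qed

section \<open>Companion series of odd order in terms of one Fine sum\<close>

lemma f_a_trunc_odd: "f_a_trunc k q = 4 * fine_sum k (q\<^sup>2) (- q) (- 1)"
  unfolding f_a_trunc_def fine_sum_odd_eq[symmetric] unfolding fine_sum_def sum_distrib_left
  by (intro sum.cong refl) (simp add: power_minus[of q])

lemma frak_f_a_trunc_odd: "frak_f_a_trunc k q = 4 * fine_sum k (q\<^sup>2) (- q) (- 1) - 4"
  unfolding frak_f_a_trunc_def fine_sum_odd_eq' by simp

lemma chi_a_trunc_odd: "chi_a_trunc k q = fine_sum k (q\<^sup>2) (- q) (- 1)"
  using f_a_trunc_odd by (simp add: chi_a_trunc_def f_a_trunc_def)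

lemma X_a_trunc_odd: "X_a_trunc k q = fine_sum k (q\<^sup>2) (- q) (- 1) - 1"
  unfolding X_a_trunc_def fine_sum_odd_eq' by (simp add: field_simps)

lemma psi_a_trunc_odd: "psi_a_trunc k (- q) = - fine_sum k (q\<^sup>2) (- q) (- 1)"
  unfolding psi_a_trunc_def fine_sum_odd_eq[symmetric] unfolding fine_sum_def sum_distrib_left
  by (simp add: mult_ac flip: sum_negf)

lemma phi_a_trunc_odd: "phi_a_trunc k (- q) = 2 * fine_sum k (q\<^sup>2) (- q) (- 1) - 2"
proof -
  have "(\<Sum>n<k. qpoch (- q) ((- q)\<^sup>2) n * (-1) ^ n * (- q) ^ (2 * n + 1))
      = - (\<Sum>n<k. qpoch (- q) (q\<^sup>2) n * (- 1) ^ n * q ^ (2 * n + 1))"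
    unfolding sum_negf[symmetric] by (intro sum.cong refl) (simp add: power_mult)
  then show ?thesis unfolding phi_a_trunc_def fine_sum_odd_eq' by simp
qed

section \<open>Mock theta functions at odd order\<close>

lemma mock_psi_odd:
  "well_defined_series (mock_psi_den (- q)) (mock_psi_term (- q)) \<and>
   mock_psi (- q) = 1/3 * psi_a_trunc k (- q)"
proof -
  have den: "mock_psi_den (- q) n \<noteq> 0" for n
    using qpoch_nonzero[of "q\<^sup>2" k "- q"] primitive_root_power[OF odd_root_facts(5)] odd_root_facts
    by (simp add: mock_psi_den_def)
  \<comment> \<open>The numerator changes sign because \<open>(- q) ^ k = -1\<close> occurs to an
    odd power; the denominator doubles.\<close>
  have per: "mock_psi_term (- q) (n + k) = - (1/2) * mock_psi_term (- q) n" for n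
  proof -
    have "(- q) ^ ((n + k + 1)\<^sup>2) = - ((- q) ^ ((n + 1)\<^sup>2))"
      using power_square_shift[of "- q" "n + 1" k] odd odd_root_facts(4)
      by (simp add: power_minus_odd add_ac)
    moreover have "qpoch (- q) (q\<^sup>2) (n + k + 1) = 2 * qpoch (- q) (q\<^sup>2) (n + 1)"
      using qpoch_period[OF odd_root_facts(5), of "- q" "n + 1"] odd_root_facts(4) by (simp add: add_ac)
    ultimately show ?thesis by (simp add: mock_psi_term_def mock_psi_den_def)
  qed
  note S = well_defined_series_period[of k "mock_psi_den (- q)" "mock_psi_term (- q)" "- (1/2)", OF odd_root_facts(1) den per]
  \<comment> \<open>Here \<open>x = - (q\<^sup>2)\<close> and \<open>t = - q\<close>, so
    \<open>- x * t\<close> is \<open>- (q ^ 3)\<close>; the outer \<open>q\<close> supplies, up to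
    sign, the factor left over from the exponent (n + 1)^2.\<close>
  have "q * fine_sum k (q\<^sup>2) (- (q\<^sup>2)) (- q)
      = q * (2 * (\<Sum>n<k. (- (q ^ 3)) ^ n * (q\<^sup>2) ^ (n choose 2) / qpoch (- q) (q\<^sup>2) (Suc n)))"
    using fine_sum_eq[OF odd_root_facts(5), of "- (q\<^sup>2)" "- q"] odd_root_facts(4) odd
      primitive_root_power[OF odd_root_facts(5)]
    by (simp add: power_minus_odd power3_eq_cube power2_eq_square mult.assoc)
  also have "\<dots> = - 2 * (\<Sum>n<k. mock_psi_term (- q) n)"
    unfolding sum_distrib_left
  proof (intro sum.cong refl)
    fix n
    have "(- q) ^ ((n + 1)\<^sup>2) = - q * ((- q) ^ n * (q\<^sup>2) ^ n * (q\<^sup>2) ^ (n choose 2))"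
      unfolding power_square_conv_choose[of "- q"] by (simp add: choose_two_Suc power_add)
    also have "(- q) ^ n * (q\<^sup>2) ^ n = (- (q ^ 3)) ^ n"
      by (simp add: power3_eq_cube power2_eq_square mult.assoc flip: power_mult_distrib)
    finally show "q * (2 * ((- (q ^ 3)) ^ n * (q\<^sup>2) ^ (n choose 2) / qpoch (- q) (q\<^sup>2) (Suc n)))
        = - 2 * mock_psi_term (- q) n"
      by (simp add: mock_psi_term_def mock_psi_den_def)
  qed
  finally have "(\<Sum>n<k. mock_psi_term (- q) n) = - fine_sum k (q\<^sup>2) (- q) (- 1) / 2"
    unfolding fine_sum_odd_eq by simp
  then show ?thesis using S by (simp add: mock_psi_def psi_a_trunc_odd)
qed

lemma mock_phi_odd:
  "well_defined_series (mock_phi_den (- q)) (mock_phi_term (- q)) \<and>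
   mock_phi (- q) = 2/3 + 1/3 * phi_a_trunc k (- q)"
proof -
  have x: "(- (q\<^sup>2)) ^ k = -1"
    using primitive_root_power[OF odd_root_facts(5)] odd by (simp add: power_minus_odd)
  have den: "mock_phi_den (- q) n \<noteq> 0" for n
    using qpoch_nonzero[of "q\<^sup>2" k "- (q\<^sup>2)"] primitive_root_power[OF odd_root_facts(5)] x
    by (simp add: mock_phi_den_def)
  have per: "mock_phi_term (- q) (n + k) = - (1/2) * mock_phi_term (- q) n" for n
    using power_square_shift[of "- q" n k] odd odd_root_facts(4) qpoch_period[OF odd_root_facts(5), of "- (q\<^sup>2)" n] x
    by (simp add: power_minus_odd mock_phi_term_def mock_phi_den_def)
  note S = well_defined_series_period[of k "mock_phi_den (- q)" "mock_phi_term (- q)" "- (1/2)", OF odd_root_facts(1) den per]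
  have "(\<Sum>n<k. mock_phi_term (- q) n) = fine_sum k (q\<^sup>2) (- q) (- 1)"
    using fine_sum_phi by (simp add: mock_phi_term_def mock_phi_den_def)
  then show ?thesis using S by (simp add: mock_phi_def phi_a_trunc_odd field_simps)
qed

text \<open>The prefactor of \<open>rank_sum_reverse\<close> at \<open>x = -1\<close> is 2 * 2 / 4 =
  1, and base change at \<open>a = - q\<close> has \<open>q / a = -1\<close>, so a period of the
  series sums to the common Fine sum.\<close>

lemma mock_f_odd:
  "well_defined_series (mock_f_den q) (mock_f_term q) \<and> mock_f q = 1/3 * f_a_trunc k q \<and>
   1/3 * f_a_trunc k q = 4/3 + 1/3 * frak_f_a_trunc k q"
proof -
  have den: "mock_f_den q n \<noteq> 0" for n
    using qpoch_nonzero[of q k "- q"] odd_root_facts by (simp add: mock_f_den_def)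
  have per: "mock_f_term q (n + k) = 1/4 * mock_f_term q n" for n
    using power_square_shift[of q n k] odd_root_facts qpoch_period[OF q, of "- q" n]
    by (simp add: mock_f_term_def mock_f_den_def power_mult_distrib)
  note S = well_defined_series_period[of k "mock_f_den q" "mock_f_term q" "1/4", OF odd_root_facts(1) den per]
  have "(\<Sum>n<k. mock_f_term q n) = q * heine_sum k q (- q) (- q)"
    using rank_sum_reverse[OF q, of "- 1"] odd
    by (simp add: mock_f_term_def mock_f_den_def power2_eq_square)
  also have "\<dots> = fine_sum k (q\<^sup>2) (- q) (- 1)"
    using heine_sum_eq_fine_sum_odd[OF q odd, of "- q"] odd_root_facts by simp
  finally show ?thesis
    using S by (simp add: mock_f_def f_a_trunc_odd frak_f_a_trunc_odd diff_divide_distrib)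
qed

text \<open>Passes from parameters with product q^2, as in \<open>rank_sum_reverse\<close>, to
  parameters with product q, as in the trisection.\<close>

lemma heine_sum_rank_eq:
  assumes "x ^ k = -1"
  shows "(1 - x) * (q * heine_sum k q (x * q) (q / x)) = - x * (3 + x * heine_sum k q x (q / x))"
proof -
  have x0: "x \<noteq> 0" using assms odd_root_facts(1) by (auto simp: power_0_left)
  have "q / x * (1 - x) * heine_sum k q (x * q) (q / x) = - (3 + x * heine_sum k q x (q / x))"
    using heine_sum_step[OF q, of "q / x" x] assms odd_root_facts by (simp add: power_divide)
  then show ?thesis using x0 by (simp add: field_simps)
qed

text \<open>Apply \<open>heine_sum_rank_eq\<close> at -1, \<open>- w\<close> and
  \<open>- (w\<^sup>2)\<close>. By symmetry the last two concern the same sum, and the trisection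
  eliminates the values \<open>V\<close>.\<close>

lemma heine_sum_rank_cube_root:
  assumes "3 dvd k" "w\<^sup>2 + w + 1 = 0"
  shows "heine_sum k q (- w * q) (- (w\<^sup>2) * q) = heine_sum k q (- q) (- q)"
proof -
  have w3: "w ^ 3 = 1" using assms(2) by algebra
  have w0: "w \<noteq> 0" using w3 by (auto simp: power_0_left)
  have wk: "w ^ k = 1" using w3 \<open>3 dvd k\<close> by (metis dvdE power_mult power_one)
  have w2k: "(w\<^sup>2) ^ k = 1" using wk by (metis power_mult mult.commute power_one)
  have inv: "q / w = w\<^sup>2 * q" "q / w\<^sup>2 = w * q"
    using w0 w3 by (simp_all add: field_simps power2_eq_square power3_eq_cube)
  define V where "V x = heine_sum k q x (q / x)" for x
  define A where "A = q * heine_sum k q (- w * q) (- (w\<^sup>2) * q)"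
  define B where "B = q * heine_sum k q (- q) (- q)"
  have "2 * B = 3 - V (- 1)"
    using heine_sum_rank_eq[of "- 1"] odd by (simp add: B_def V_def)
  moreover have "(1 + w) * A = w * (3 - w * V (- w))"
    using heine_sum_rank_eq[of "- w"] wk odd by (simp add: A_def V_def inv)
  moreover have "(1 + w\<^sup>2) * A = w\<^sup>2 * (3 - w\<^sup>2 * V (- (w\<^sup>2)))"
    using heine_sum_rank_eq[of "- (w\<^sup>2)"] w2k odd
    by (simp add: A_def V_def inv heine_sum_commute[of k q "- (w\<^sup>2 * q)"])
  moreover have "V (- 1) + V (- w) + V (- (w\<^sup>2)) = 0"
    using heine_sum_trisection[OF q assms, of "- 1"] by (simp add: V_def)
  moreover have "2 * a = 2 * b"
    if "2 * b = 3 - u" "(1 + w) * a = w * (3 - w * v)" "(1 + w\<^sup>2) * a = w\<^sup>2 * (3 - w\<^sup>2 * v')"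
      "u + v + v' = 0" for a b u v v' :: complex
  proof -
    \<comment> \<open>Divide by 1 + w = -w^2, and below by 1 + w^2 = -w; adding the results gives 2a
      = v + v' + 3 = 3 - u = 2b.\<close>
    have "a = v - 3 * w\<^sup>2" using that(2) assms(2) by algebra
    moreover have "a = v' - 3 * w" using that(3) assms(2) by algebra
    ultimately show ?thesis using that(1,4) assms(2) by algebra
  qed
  ultimately have "2 * A = 2 * B" by blast
  then have "A = B" by simp
  then show ?thesis using odd_root_facts(3) by (simp add: A_def B_def)
qed

text \<open>Since 1 - y + y^2 = (1 + w y)(1 + w^2 y), the series is the rank series at
  \<open>- w\<close>. Its prefactor has (1 + w)(1 + w^2) = 1, so a period sums to a quarter of the
  period of f.\<close>

lemma mock_chi_odd:
  assumes "3 dvd k"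
  shows "well_defined_series (mock_chi_den q) (mock_chi_term q) \<and> mock_chi q = 1/3 * chi_a_trunc k q \<and>
    1/3 * chi_a_trunc k q = 1/3 + 1/3 * X_a_trunc k q"
proof -
  obtain w :: complex where w: "w\<^sup>2 + w + 1 = 0" by (rule primitive_cube_root_of_unity_exists)
  have w3: "w ^ 3 = 1" using w by algebra
  have w0: "w \<noteq> 0" using w3 by (auto simp: power_0_left)
  have wk: "w ^ k = 1" using w3 \<open>3 dvd k\<close> by (metis dvdE power_mult power_one)
  have w2k: "(w\<^sup>2) ^ k = 1" using wk by (metis power_mult mult.commute power_one)
  have inv: "q / - w = - (w\<^sup>2) * q"
    using w0 w3 by (simp add: field_simps power2_eq_square power3_eq_cube)
  have den_eq: "mock_chi_den q n = qpoch (- w * q) q n * qpoch (- (w\<^sup>2) * q) q n" for n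
  proof (induction n)
    case (Suc n)
    have "1 - y + y\<^sup>2 = (1 - - w * y) * (1 - - (w\<^sup>2) * y)" for y
      using w by algebra
    from this[of "q ^ Suc n"] have "1 - q ^ Suc n + q ^ (2 * Suc n)
        = (1 - - w * q * q ^ n) * (1 - - (w\<^sup>2) * q * q ^ n)"
      by (simp add: mult.assoc power_mult[symmetric] mult.commute[of _ 2] flip: power_Suc)
    moreover have "mock_chi_den q (Suc n) = mock_chi_den q n * (1 - q ^ Suc n + q ^ (2 * Suc n))"
      by (simp add: mock_chi_den_def)
    ultimately show ?case using Suc by (simp only: qpoch_Suc mult_ac)
  qed (simp add: mock_chi_den_def)
  have x: "(- w * q) ^ k = -1" "(- (w\<^sup>2) * q) ^ k = -1"
    using wk w2k odd odd_root_facts by (simp_all add: power_mult_distrib power_minus_odd)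
  have den: "mock_chi_den q n \<noteq> 0" for n
    unfolding den_eq using x qpoch_nonzero[OF odd_root_facts(2), of "- w * q" n]
      qpoch_nonzero[OF odd_root_facts(2), of "- (w\<^sup>2) * q" n] by simp
  have per: "mock_chi_term q (n + k) = 1/4 * mock_chi_term q n" for n
    using power_square_shift[of q n k] odd_root_facts(2)
    unfolding mock_chi_term_def den_eq qpoch_period[OF q] x by simp
  note S = well_defined_series_period[of k "mock_chi_den q" "mock_chi_term q" "1/4", OF odd_root_facts(1) den per]
  have "(- w) ^ k = -1" using wk odd by simp
  then have "(\<Sum>n<k. mock_chi_term q n)
      = (1 - - w) * (1 - 1 / - w) / 4 * (q * heine_sum k q (- w * q) (- (w\<^sup>2) * q))"
    unfolding mock_chi_term_def den_eq using rank_sum_reverse[OF q, of "- w"] unfolding inv by simp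
  also have "(1 - - w) * (1 - 1 / - w) = 1"
  proof -
    have "1 / - w = - (w\<^sup>2)" using w0 w3 by (simp add: field_simps power2_eq_square power3_eq_cube)
    then show ?thesis using w w3 by algebra
  qed
  also have "1 / 4 * (q * heine_sum k q (- w * q) (- (w\<^sup>2) * q)) = fine_sum k (q\<^sup>2) (- q) (- 1) / 4"
    using heine_sum_eq_fine_sum_odd[OF q odd, of "- q"] odd_root_facts
    unfolding heine_sum_rank_cube_root[OF assms w] by simp
  finally show ?thesis
    using S by (simp add: mock_chi_def chi_a_trunc_odd X_a_trunc_odd diff_divide_distrib)
qed

end

section \<open>Order divisible by four\<close>

context
  fixes k l :: nat and q :: complex
  assumes q: "primitive_root k q" and k: "k = 4 * l"
begin

lemma root_4_facts:
  shows "l > 0" "q ^ (2 * l) = -1" "q \<noteq> 0" "primitive_root (2 * l) (q\<^sup>2)" "primitive_root l (q ^ 4)"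
proof -
  show "l > 0" "q \<noteq> 0"
    using q k by (auto dest: primitive_root_pos primitive_root_nonzero)
  show "q ^ (2 * l) = -1" by (rule primitive_root_half) (use q k in simp)
  show "primitive_root (2 * l) (q\<^sup>2)" "primitive_root l (q ^ 4)"
    by (rule primitive_root_power_div[OF q]; use k in simp)+
qed

lemma sq_power_l: "(q\<^sup>2) ^ l = -1"
  using root_4_facts(2) by (simp add: power_mult)

text \<open>The companion sums have \<open>4 * l\<close> terms but base \<open>q\<^sup>2\<close> has
  order \<open>2 * l\<close>. In the second half the symbol doubles and
  \<open>q ^ (2 * l) = -1\<close>, so the total is 1 - 2 = -1 times the first half.\<close>

lemma fine_sum_double: "(\<Sum>n<k. qpoch (- q) (q\<^sup>2) n * q ^ n) = - fine_sum (2 * l) (q\<^sup>2) (- q) q"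
proof -
  have "(\<Sum>n<m + j. g n) = (\<Sum>n<m. g n) + (\<Sum>n<j. g (n + m))" for g :: "nat \<Rightarrow> complex" and m j
    by (induction j) (simp_all add: ac_simps)
  moreover have "k = 2 * l + 2 * l" using k by simp
  ultimately have "(\<Sum>n<k. qpoch (- q) (q\<^sup>2) n * q ^ n)
      = fine_sum (2 * l) (q\<^sup>2) (- q) q + (\<Sum>n<2 * l. qpoch (- q) (q\<^sup>2) (n + 2 * l) * q ^ (n + 2 * l))"
    by (simp only: fine_sum_def)
  also have "(\<Sum>n<2 * l. qpoch (- q) (q\<^sup>2) (n + 2 * l) * q ^ (n + 2 * l)) = - 2 * fine_sum (2 * l) (q\<^sup>2) (- q) q"
    unfolding qpoch_period[OF root_4_facts(4)] power_add fine_sum_def sum_distrib_left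
    using root_4_facts(2) by (intro sum.cong refl) simp
  finally show ?thesis by simp
qed

section \<open>Companion series for order divisible by four\<close>

lemma nu_a_trunc_even: "nu_a_trunc k (- q) = - fine_sum (2 * l) (q\<^sup>2) (- q) q"
  unfolding nu_a_trunc_def fine_sum_double[symmetric]
  by (intro sum.cong refl) (simp add: power_minus[of q])

lemma fine_sum_even_eq: "fine_sum (2 * l) (q\<^sup>2) (- q) q = q * heine_sum l (q ^ 4) (q\<^sup>2) (q\<^sup>2)"
proof -
  have "- (q\<^sup>2) / (- q) = q" using root_4_facts(3) by (simp add: power2_eq_square)
  then show ?thesis
    using heine_sum_eq_fine_sum_even[of l q "- q"] q k root_4_facts(2) by simp
qed

lemma omega_a_trunc_even: "omega_a_trunc k (q\<^sup>2) q = - heine_sum l (q ^ 4) (q\<^sup>2) (q\<^sup>2)"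
  unfolding omega_a_trunc_def fine_sum_double fine_sum_even_eq using root_4_facts(3) by simp

lemma rho_a_trunc_even: "rho_a_trunc k (q\<^sup>2) q = heine_sum l (q ^ 4) (q\<^sup>2) (q\<^sup>2) / 2"
  unfolding rho_a_trunc_def fine_sum_double fine_sum_even_eq using root_4_facts(3) by simp

section \<open>The functions nu, omega and rho\<close>

lemma mock_nu_even:
  "well_defined_series (mock_nu_den (- q)) (mock_nu_term (- q)) \<and>
   mock_nu (- q) = - (1/3) * nu_a_trunc k (- q)"
proof -
  have q2: "(q\<^sup>2) ^ (2 * l) = 1" using primitive_root_power[OF root_4_facts(4)] .
  have den: "mock_nu_den (- q) n \<noteq> 0" for n
    using qpoch_nonzero[OF q2, of q] root_4_facts(2) by (simp add: mock_nu_den_def)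
  \<comment> \<open>The period is the order of \<open>q\<^sup>2\<close>, half of \<open>k\<close>;
    the numerator gains an odd power of -1 and the denominator doubles.\<close>
  have per: "mock_nu_term (- q) (n + 2 * l) = - (1/2) * mock_nu_term (- q) n" for n
  proof -
    have "(- q) ^ ((n + 2 * l)\<^sup>2 + (n + 2 * l)) = - ((- q) ^ (n\<^sup>2 + n))"
      using power_product_shift[of "- q" n "2 * l"] root_4_facts(2)
      by (simp add: power2_eq_square power_mult add.commute)
    then show ?thesis
      using qpoch_period[OF root_4_facts(4), of q "n + 1"] root_4_facts(2)
      by (simp add: mock_nu_term_def mock_nu_den_def)
  qed
  have "2 * l > 0" using root_4_facts(1) by simp
  note S = well_defined_series_period[of "2 * l" "mock_nu_den (- q)" "mock_nu_term (- q)" "- (1/2)", OF this den per]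
  have "fine_sum (2 * l) (q\<^sup>2) (- q) q
     = 2 * (\<Sum>n<2 * l. (q\<^sup>2) ^ n * (q\<^sup>2) ^ (n choose 2) / qpoch q (q\<^sup>2) (Suc n))"
    using fine_sum_eq[OF root_4_facts(4), of "- q" q] root_4_facts(2) by (simp add: power2_eq_square)
  also have "\<dots> = 2 * (\<Sum>n<2 * l. mock_nu_term (- q) n)"
  proof -
    have "(q\<^sup>2) ^ n * (q\<^sup>2) ^ (n choose 2) = (- q) ^ (n\<^sup>2 + n)" for n
    proof -
      have "(q\<^sup>2) ^ n = (- q) ^ n * (- q) ^ n"
        by (simp add: power2_eq_square flip: power_mult_distrib)
      then show ?thesis
        by (simp only: power_add power_square_conv_choose[of "- q"] power2_minus mult_ac)
    qed
    then show ?thesis by (simp add: mock_nu_term_def mock_nu_den_def)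
  qed
  finally show ?thesis using S by (simp add: mock_nu_def nu_a_trunc_even)
qed

lemma q4_power_product: "(q ^ 4) ^ ((n + l) * Suc (n + l)) = (q ^ 4) ^ (n * Suc n)"
  using power_product_shift[of "q ^ 4" n l] primitive_root_power[OF root_4_facts(5)] by simp

text \<open>In base \<open>q ^ 4\<close> the denominator is the square of a symbol at
  \<open>q\<^sup>2\<close>, and q^2 * q^2 = q^4 is what the reversal requires.\<close>

lemma mock_omega_even:
  "well_defined_series (mock_omega_den (q\<^sup>2)) (mock_omega_term (q\<^sup>2)) \<and>
   mock_omega (q\<^sup>2) = - (1/3) * omega_a_trunc k (q\<^sup>2) q"
proof -
  have trm: "mock_omega_term (q\<^sup>2) n = (q ^ 4) ^ (n * Suc n) / (qpoch (q\<^sup>2) (q ^ 4) (Suc n))\<^sup>2" for n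
    by (simp add: mock_omega_term_def mock_omega_den_def mult.assoc flip: power_mult)
  have den: "mock_omega_den (q\<^sup>2) n \<noteq> 0" for n
    using qpoch_nonzero[OF primitive_root_power[OF root_4_facts(5)], of "q\<^sup>2"] sq_power_l
    by (simp add: mock_omega_den_def flip: power_mult)
  have per: "mock_omega_term (q\<^sup>2) (n + l) = 1/4 * mock_omega_term (q\<^sup>2) n" for n
    using qpoch_period[OF root_4_facts(5), of "q\<^sup>2" "Suc n"] sq_power_l
    unfolding trm q4_power_product by (simp add: power_mult_distrib)
  note S = well_defined_series_period[of l "mock_omega_den (q\<^sup>2)" "mock_omega_term (q\<^sup>2)" "1/4", OF root_4_facts(1) den per]
  have "(\<Sum>n<l. mock_omega_term (q\<^sup>2) n) = heine_sum l (q ^ 4) (q\<^sup>2) (q\<^sup>2) / 4"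
  proof -
    have "q\<^sup>2 * q\<^sup>2 = q ^ 4" by (simp flip: power_add)
    then show ?thesis
      using heine_sum_reverse[OF root_4_facts(5) _ sq_power_l]
      unfolding trm power2_eq_square[of "qpoch _ _ _"] by blast
  qed
  then show ?thesis using S by (simp add: mock_omega_def omega_a_trunc_even)
qed

text \<open>Trisection at \<open>a = q\<^sup>2\<close> in base \<open>q ^ 4\<close>, where q^4 / a =
  a: the two remaining points give the same sum by symmetry.\<close>

lemma heine_sum_cube_root:
  assumes "3 dvd l" "w\<^sup>2 + w + 1 = 0"
  shows "heine_sum l (q ^ 4) (w * q\<^sup>2) (w\<^sup>2 * q\<^sup>2) = - heine_sum l (q ^ 4) (q\<^sup>2) (q\<^sup>2) / 2"
proof -
  have w3: "w ^ 3 = 1" using assms(2) by algebra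
  have w0: "w \<noteq> 0" using w3 by (auto simp: power_0_left)
  have "q ^ 4 / q\<^sup>2 = q\<^sup>2" "q ^ 4 / (w * q\<^sup>2) = w\<^sup>2 * q\<^sup>2" "q ^ 4 / (w\<^sup>2 * q\<^sup>2) = w * q\<^sup>2"
    using w0 w3 root_4_facts(3)
    by (simp_all add: field_simps power2_eq_square power3_eq_cube power4_eq_xxxx)
  then have "2 * heine_sum l (q ^ 4) (w * q\<^sup>2) (w\<^sup>2 * q\<^sup>2) = - heine_sum l (q ^ 4) (q\<^sup>2) (q\<^sup>2)"
    using heine_sum_trisection[OF root_4_facts(5) assms, of "q\<^sup>2"] root_4_facts(3)
      heine_sum_commute[of l "q ^ 4" "w * q\<^sup>2"] by (simp add: eq_neg_iff_add_eq_0 add_ac)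
  from arg_cong[OF this, of "\<lambda>z. z / 2"] show ?thesis by simp
qed

text \<open>By 1 + y + y^2 = (1 - w y)(1 - w^2 y) the argument for omega applies with parameters
  \<open>w * q\<^sup>2\<close> and \<open>w\<^sup>2 * q\<^sup>2\<close>; the factor -1/2 of
  \<open>heine_sum_cube_root\<close> is the prefactor of the rho companion.\<close>

lemma mock_rho_even:
  assumes "3 dvd l"
  shows "well_defined_series (mock_rho_den (q\<^sup>2)) (mock_rho_term (q\<^sup>2)) \<and>
   mock_rho (q\<^sup>2) = - (1/3) * rho_a_trunc k (q\<^sup>2) q"
proof -
  obtain w :: complex where w: "w\<^sup>2 + w + 1 = 0" by (rule primitive_cube_root_of_unity_exists)
  have w3: "w ^ 3 = 1" using w by algebra
  have wl: "w ^ l = 1" using w3 \<open>3 dvd l\<close> by (metis dvdE power_mult power_one)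
  have x: "(w * q\<^sup>2) ^ l = -1" "(w\<^sup>2 * q\<^sup>2) ^ l = -1"
    using wl sq_power_l by (simp_all add: power_mult_distrib)
      (metis power_mult mult.commute power_one)
  have den_eq: "mock_rho_den (q\<^sup>2) n = qpoch (w * q\<^sup>2) (q ^ 4) (Suc n) * qpoch (w\<^sup>2 * q\<^sup>2) (q ^ 4) (Suc n)" for n
  proof -
    have "1 + (q\<^sup>2) ^ (2 * j + 1) + (q\<^sup>2) ^ (4 * j + 2)
        = (1 - w * q\<^sup>2 * (q ^ 4) ^ j) * (1 - w\<^sup>2 * q\<^sup>2 * (q ^ 4) ^ j)" for j
    proof -
      define y where "y = q\<^sup>2 * (q ^ 4) ^ j"
      have y: "(q\<^sup>2) ^ (2 * j + 1) = y"
        by (simp add: y_def flip: power_mult)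
      moreover have "(q\<^sup>2) ^ (4 * j + 2) = y\<^sup>2"
        unfolding y[symmetric] by (simp only: power_mult[symmetric]) (rule arg_cong[of _ _ "power q"], simp)
      moreover have "1 + y + y\<^sup>2 = (1 - w * y) * (1 - w\<^sup>2 * y)" using w by algebra
      ultimately show ?thesis by (simp only: y_def mult.assoc)
    qed
    then show ?thesis
      by (simp add: mock_rho_den_def qpoch_def atLeast0AtMost lessThan_Suc_atMost prod.distrib
          del: prod.lessThan_Suc)
  qed
  have den: "mock_rho_den (q\<^sup>2) n \<noteq> 0" for n
    unfolding den_eq using x qpoch_nonzero[OF primitive_root_power[OF root_4_facts(5)]] by simp
  have trm: "mock_rho_term (q\<^sup>2) n = (q ^ 4) ^ (n * Suc n)
      / (qpoch (w * q\<^sup>2) (q ^ 4) (Suc n) * qpoch (w\<^sup>2 * q\<^sup>2) (q ^ 4) (Suc n))" for n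
    by (simp add: mock_rho_term_def den_eq mult.assoc flip: power_mult)
  have per: "mock_rho_term (q\<^sup>2) (n + l) = 1/4 * mock_rho_term (q\<^sup>2) n" for n
    using qpoch_period[OF root_4_facts(5), of "w * q\<^sup>2" "Suc n"]
      qpoch_period[OF root_4_facts(5), of "w\<^sup>2 * q\<^sup>2" "Suc n"] x
    unfolding trm q4_power_product by simp
  note S = well_defined_series_period[of l "mock_rho_den (q\<^sup>2)" "mock_rho_term (q\<^sup>2)" "1/4", OF root_4_facts(1) den per]
  have "w * q\<^sup>2 * (w\<^sup>2 * q\<^sup>2) = q ^ 4"
    using w3 by algebra
  then have "(\<Sum>n<l. mock_rho_term (q\<^sup>2) n) = heine_sum l (q ^ 4) (w * q\<^sup>2) (w\<^sup>2 * q\<^sup>2) / 4"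
    using heine_sum_reverse[OF root_4_facts(5) _ x(1), of "w\<^sup>2 * q\<^sup>2"]
    unfolding trm by simp
  then show ?thesis
    using S heine_sum_cube_root[OF assms w] by (simp add: mock_rho_def rho_a_trunc_even)
qed

end

theorem theorem1p3:
  fixes k :: nat and h :: int and q :: complex
  assumes "k \<ge> 1" and "gcd h (int k) = 1" and "q = zeta k powi h"
  shows "(k mod 2 = 1 \<longrightarrow>
            well_defined_series (mock_psi_den (- q)) (mock_psi_term (- q)) \<and>
            mock_psi (- q) = 1/3 * psi_a_trunc k (- q)) \<and>
         (k mod 2 = 1 \<longrightarrow>
            well_defined_series (mock_phi_den (- q)) (mock_phi_term (- q)) \<and>
            mock_phi (- q) = 2/3 + 1/3 * phi_a_trunc k (- q)) \<and>
         (k mod 4 = 0 \<longrightarrow>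
            well_defined_series (mock_nu_den (- q)) (mock_nu_term (- q)) \<and>
            mock_nu (- q) = - (1/3) * nu_a_trunc k (- q)) \<and>
         (k mod 4 = 0 \<longrightarrow>
            well_defined_series (mock_omega_den (q\<^sup>2)) (mock_omega_term (q\<^sup>2)) \<and>
            mock_omega (q\<^sup>2) = - (1/3) * omega_a_trunc k (q\<^sup>2) q) \<and>
         (k mod 12 = 0 \<longrightarrow>
            well_defined_series (mock_rho_den (q\<^sup>2)) (mock_rho_term (q\<^sup>2)) \<and>
            mock_rho (q\<^sup>2) = - (1/3) * rho_a_trunc k (q\<^sup>2) q) \<and>
         (k mod 2 = 1 \<longrightarrow>
            well_defined_series (mock_f_den q) (mock_f_term q) \<and>
            mock_f q = 1/3 * f_a_trunc k q \<and>
            1/3 * f_a_trunc k q = 4/3 + 1/3 * frak_f_a_trunc k q) \<and>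
         (k mod 6 = 3 \<longrightarrow>
            well_defined_series (mock_chi_den q) (mock_chi_term q) \<and>
            mock_chi q = 1/3 * chi_a_trunc k q \<and>
            1/3 * chi_a_trunc k q = 1/3 + 1/3 * X_a_trunc k q)"
proof -
  have q: "primitive_root k q"
    using assms primitive_root_zeta by simp
  have odd: "odd k" if "k mod 2 = 1"
    using that by presburger
  have mod4: "k = 4 * (k div 4)" if "k mod 4 = 0"
    using that by presburger
  have mod12: "k mod 4 = 0" "3 dvd k div 4" if "k mod 12 = 0"
    using that by presburger+
  have mod6: "k mod 2 = 1" "3 dvd k" if "k mod 6 = 3"
    using that by presburger+
  show ?thesis
    by (rule impI mock_psi_odd[OF q odd] mock_phi_odd[OF q odd] mock_nu_even[OF q mod4]
      mock_omega_even[OF q mod4] mock_rho_even[OF q mod4[OF mod12(1)] mod12(2)] mock_f_odd[OF q odd]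
      mock_chi_odd[OF q odd[OF mod6(1)] mod6(2)] conjI | assumption)+
qed

end
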